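(* Let $G$ be a finite subgroup of $\mathsf{O}(d)$ and let $\sigma$ be the inertia spectrum of some $G$-symmetric configuration of $n$ particles in $\mathbb{R}^d$. Then $\mathcal{C}(\sigma)^G$ is a non-empty closed subset of $\mathcal{C}(\sigma)$, and there is a symmetric balanced configuration in each connected component of $\mathcal{C}(\sigma)^G$, and indeed in $\mathcal{C}(\sigma)(\Gamma)$ for any topological Burnside type $\Gamma$ for which $\mathcal{C}(\sigma)(\Gamma)$ is non-empty.
   Context: **Configurations.** A configuration of $n$ particles in $\mathbb{R}^d$ is a pair $(C,m)$, where $C\subset\mathbb{R}^d$ is a set of $n$ distinct points and $m:C\to\mathbb{R}^+=(0,\infty)$ is a function (the masses). Throughout this statement configurations have centre of mass at the origin: $\sum_{x\in C}m(x)x=0$. The topology and manifold structure on the set of configurations are obtained by identifying it locally with ordered configurations $(x_1,\dots,x_n)$ of distinct points (for any choice of ordering), the mass function being taken to be locally constant (nearby configurations have the same masses at corresponding points). **Symmetric configurations.** $g\in\mathsf{O}(d)$ acts by $g\cdot(C,m)=(gC,m\circ g^{-1})$. A configuration is ($G$-)symmetric if it is fixed by all $g\in G$, i.e. $gC=C$ and $m(gx)=m(x)$ for all $g\in G$, $x\in C$. **Topological Burnside type.** For $x\in\mathbb{R}^d$ let $G_x=\{g\in G:gx=x\}$. The orbit $G\cdot x$ has orbit type $(H)$ if $G_x$ is conjugate in $G$ to $H$; here $(H)$ denotes the conjugacy class of $H$. Let $X_H\subset\mathbb{R}^d/G$ be the set of orbits of type $(H)$ and $X_H^\alpha$ its connected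 components; an orbit in $X_H^\alpha$ has topological type $(H)^\alpha$. A topological Burnside type is a formal finite sum $\Gamma=\sum a_H^\alpha(H)^\alpha$ with $a_H^\alpha\in\{0,1,2,\dots\}$. A symmetric configuration $(C,m)$ has topological Burnside type $\Gamma$ if $C$ consists, for each $(H)^\alpha$, of exactly $a_H^\alpha$ orbits of topological type $(H)^\alpha$. **Inertia spectrum.** For a configuration $(C,m)$ with $C=\{x_1,\dots,x_n\}$, $m_i=m(x_i)$, let $X$ be the $d\times n$ matrix with columns $x_1,\dots,x_n$, let $\mu=\mathrm{diag}(m_1,\dots,m_n)$, and let $S=X\mu X^T$, a $d\times d$ symmetric matrix independent of the ordering. The inertia spectrum of the configuration is the spectrum of $S$, with multiplicities. $\mathcal{C}(\sigma)$ denotes the space of all configurations (of $n$ particles in $\mathbb{R}^d$) with inertia spectrum $\sigma$, $\mathcal{C}(\sigma)^G$ the subset of $G$-symmetric ones, and $\mathcal{C}(\sigma)(\Gamma)$ the subset of $\mathcal{C}(\sigma)^G$ of those of topological Burnside type $\Gamma$. **Balanced configurations.** Let $$U(C)=\sum_{\{x,y\}\subset C}\frac{m(x)m(y)}{\|x-y\|},$$ the sum being over unordered pairs of distinct points of $C$. A configuration with inertia spectrum $\sigma$ is balanced if it is a critical point of the restriction of $U$ to $\mathcal{C}(\sigma)$. *)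

theory Defs
  imports "HOL-Analysis.Analysis" "HOL-Computational_Algebra.Polynomial"
begin

section \<open>Quotient topologies\<close>

definition quotient_topology :: "'a topology \<Rightarrow> ('a \<Rightarrow> 'b) \<Rightarrow> 'b topology" where
  "quotient_topology X f =
     topology (\<lambda>V. V \<subseteq> f ` topspace X \<and> openin X {x \<in> topspace X. f x \<in> V})"

lemma openin_quotient_topology:
  "openin (quotient_topology X f) V \<longleftrightarrow>
     V \<subseteq> f ` topspace X \<and> openin X {x \<in> topspace X. f x \<in> V}"
proof -
  let ?P = "\<lambda>V. V \<subseteq> f ` topspace X \<and> openin X {x \<in> topspace X. f x \<in> V}"
  have "istopology ?P"
    unfolding istopology_def
  proof (intro conjI allI impI; (elim conjE)?)
    fix S T assume "openin X {x \<in> topspace X. f x \<in> S}" "openin X {x \<in> topspace X. f x \<in> T}"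
    then have "openin X ({x \<in> topspace X. f x \<in> S} \<inter> {x \<in> topspace X. f x \<in> T})"
      by blast
    also have "\<dots> = {x \<in> topspace X. f x \<in> S \<inter> T}" by auto
    finally show "openin X {x \<in> topspace X. f x \<in> S \<inter> T}" .
  next
    fix \<K> assume K: "\<forall>K\<in>\<K>. ?P K"
    then have "openin X (\<Union>K\<in>\<K>. {x \<in> topspace X. f x \<in> K})" by blast
    also have "(\<Union>K\<in>\<K>. {x \<in> topspace X. f x \<in> K}) = {x \<in> topspace X. f x \<in> \<Union>\<K>}" by auto
    finally show "openin X {x \<in> topspace X. f x \<in> \<Union>\<K>}" .
  qed blast+
  then show ?thesis
    by (simp add: quotient_topology_def topology_inverse')
qed

lemma topspace_quotient_topology [simp]: "topspace (quotient_topology X f) = f ` topspace X"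
proof -
  have "{x \<in> topspace X. f x \<in> f ` topspace X} = topspace X" by auto
  then have "openin (quotient_topology X f) (f ` topspace X)"
    unfolding openin_quotient_topology by simp
  moreover have "topspace (quotient_topology X f) \<subseteq> f ` topspace X"
    using openin_topspace[of "quotient_topology X f"] unfolding openin_quotient_topology by blast
  ultimately show ?thesis
    by (intro subset_antisym openin_subset)
qed

lemma quotient_map_quotient_topology: "quotient_map X (quotient_topology X f) f"
  by (auto simp: quotient_map_def openin_quotient_topology)


section \<open>Configurations\<close>

text \<open>The mass function of \<open>(C, m)\<close> is defined on \<open>C\<close> only; outside \<open>C\<close> it takes the fixed
  value \<^const>\<open>undefined\<close>, so that equality of pairs is equality of configurations.\<close>

type_synonym 'd config = "(real^'d) set \<times> (real^'d \<Rightarrow> real)"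

definition configurations :: "nat \<Rightarrow> 'd::finite config set" where
  "configurations n =
     {(C, m). finite C \<and> card C = n \<and> m \<in> C \<rightarrow>\<^sub>E {0<..} \<and> (\<Sum>x\<in>C. m x *\<^sub>R x) = 0}"

text \<open>Ordered configurations \<open>((x\<^sub>0, \<dots>, x\<^sub>n\<^sub>-\<^sub>1), (m\<^sub>0, \<dots>, m\<^sub>n\<^sub>-\<^sub>1))\<close>. The masses carry the discrete
  topology, so they are locally constant.\<close>

type_synonym 'd ordered_config = "(nat \<Rightarrow> real^'d) \<times> (nat \<Rightarrow> real)"

definition ordered_configurations :: "nat \<Rightarrow> 'd::finite ordered_config set" where
  "ordered_configurations n =
     {(x, m). x \<in> {..<n} \<rightarrow>\<^sub>E UNIV \<and> m \<in> {..<n} \<rightarrow>\<^sub>E {0<..} \<and>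
              inj_on x {..<n} \<and> (\<Sum>i<n. m i *\<^sub>R x i) = 0}"

definition ordered_topology :: "nat \<Rightarrow> 'd::finite ordered_config topology" where
  "ordered_topology n =
     subtopology
       (prod_topology (product_topology (\<lambda>_. euclidean) {..<n})
                      (product_topology (\<lambda>_. discrete_topology {0<..}) {..<n}))
       (ordered_configurations n)"

definition forget_order :: "nat \<Rightarrow> 'd::finite ordered_config \<Rightarrow> 'd config" where
  "forget_order n = (\<lambda>(x, m).
     (x ` {..<n}, restrict (\<lambda>p. m (the_inv_into {..<n} x p)) (x ` {..<n})))"

text \<open>Permuting the indices acts freely on ordered configurations, so \<^const>\<open>forget_order\<close> is a
  covering map onto the quotient: locally, configurations are identified with ordered ones.\<close>

definition config_topology :: "nat \<Rightarrow> 'd::finite config topology" where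
  "config_topology n = quotient_topology (ordered_topology n) (forget_order n)"

lemma topspace_ordered_topology: "topspace (ordered_topology n) = ordered_configurations n"
  by (auto simp: ordered_topology_def ordered_configurations_def PiE_def)

lemma forget_order_in_configurations:
  assumes "p \<in> ordered_configurations n"
  shows "forget_order n p \<in> configurations n"
proof -
  obtain x m where p: "p = (x, m)" by fastforce
  have inj: "inj_on x {..<n}" and m: "\<And>i. i < n \<Longrightarrow> m i > 0" and "(\<Sum>i<n. m i *\<^sub>R x i) = 0"
    using assms by (auto simp: p ordered_configurations_def)
  moreover have "(\<Sum>q\<in>x ` {..<n}. (restrict (\<lambda>p. m (the_inv_into {..<n} x p)) (x ` {..<n})) q *\<^sub>R q)
      = (\<Sum>i<n. m i *\<^sub>R x i)"
    using inj by (subst sum.reindex) (auto simp: the_inv_into_f_f intro!: sum.cong)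
  ultimately show ?thesis
    by (auto simp: p forget_order_def configurations_def card_image the_inv_into_f_f)
qed

lemma forget_order_surj:
  assumes "c \<in> configurations n"
  shows "\<exists>p\<in>ordered_configurations n. forget_order n p = c"
proof -
  obtain C m where c: "c = (C, m)" by fastforce
  have C: "finite C" "card C = n" "m \<in> C \<rightarrow>\<^sub>E {0<..}" "(\<Sum>x\<in>C. m x *\<^sub>R x) = 0"
    using assms by (auto simp: c configurations_def)
  obtain y where y: "bij_betw y {..<n} C"
    using ex_bij_betw_nat_finite[OF C(1)] C(2) by (auto simp: atLeast0LessThan)
  define x where "x = restrict y {..<n}"
  have x: "bij_betw x {..<n} C" "x \<in> extensional {..<n}"
    using y bij_betw_cong[of "{..<n}" x y C] by (auto simp: x_def)
  then have inj: "inj_on x {..<n}" and im: "x ` {..<n} = C" by (auto simp: bij_betw_def)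
  define \<mu> where "\<mu> = restrict (m \<circ> x) {..<n}"
  have "(\<Sum>i<n. \<mu> i *\<^sub>R x i) = (\<Sum>p\<in>C. m p *\<^sub>R p)"
    using sum.reindex[OF inj, of "\<lambda>p. m p *\<^sub>R p"] by (simp add: im \<mu>_def)
  moreover have "m (x i) > 0" if "i < n" for i
    using C(3) im that by (auto simp: PiE_iff)
  ultimately have "(x, \<mu>) \<in> ordered_configurations n"
    using C(4) x inj by (auto simp: ordered_configurations_def \<mu>_def PiE_def)
  moreover have "restrict (\<lambda>p. \<mu> (the_inv_into {..<n} x p)) C = m"
  proof
    fix p show "restrict (\<lambda>p. \<mu> (the_inv_into {..<n} x p)) C p = m p"
    proof (cases "p \<in> C")
      case True
      then obtain i where "i < n" "p = x i" using im by auto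
      then show ?thesis using True inj by (simp add: \<mu>_def the_inv_into_f_f)
    qed (use C in \<open>auto simp: PiE_def extensional_def\<close>)
  qed
  ultimately show ?thesis
    by (intro bexI[of _ "(x, \<mu>)"]) (auto simp: forget_order_def c im)
qed

lemma topspace_config_topology: "topspace (config_topology n) = configurations n"
  unfolding config_topology_def topspace_quotient_topology topspace_ordered_topology
  using forget_order_in_configurations forget_order_surj by blast


section \<open>Symmetric configurations\<close>

definition orthogonal_subgroup :: "(real^'d^'d) set \<Rightarrow> bool" where
  "orthogonal_subgroup G \<longleftrightarrow>
     G \<subseteq> {A. orthogonal_matrix A} \<and> mat 1 \<in> G \<and>
     (\<forall>A\<in>G. \<forall>B\<in>G. A ** B \<in> G) \<and> (\<forall>A\<in>G. matrix_inv A \<in> G)"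

definition config_act :: "real^'d^'d \<Rightarrow> 'd::finite config \<Rightarrow> 'd config" where
  "config_act g = (\<lambda>(C, m).
     ((*v) g ` C, restrict (\<lambda>x. m (matrix_inv g *v x)) ((*v) g ` C)))"

definition symmetric_config :: "(real^'d^'d) set \<Rightarrow> 'd::finite config \<Rightarrow> bool" where
  "symmetric_config G c \<longleftrightarrow> (\<forall>g\<in>G. config_act g c = c)"


section \<open>Topological Burnside types\<close>

definition stabilizer :: "(real^'d^'d) set \<Rightarrow> real^'d \<Rightarrow> (real^'d^'d) set" where
  "stabilizer G x = {g \<in> G. g *v x = x}"

definition orbit :: "(real^'d^'d) set \<Rightarrow> real^'d \<Rightarrow> (real^'d) set" where
  "orbit G x = (\<lambda>g. g *v x) ` G"

definition orbit_space :: "(real^'d^'d) set \<Rightarrow> (real^'d) set topology" where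
  "orbit_space G = quotient_topology euclidean (orbit G)"

definition conj_class :: "(real^'d^'d) set \<Rightarrow> (real^'d^'d) set \<Rightarrow> (real^'d^'d) set set" where
  "conj_class G H = {(\<lambda>h. g ** h ** matrix_inv g) ` H | g. g \<in> G}"

definition orbits_of_type :: "(real^'d^'d) set \<Rightarrow> (real^'d^'d) set \<Rightarrow> (real^'d) set set" where
  "orbits_of_type G H = {orbit G x | x. stabilizer G x \<in> conj_class G H}"

text \<open>The topological type \<open>(H)\<^sup>\<alpha>\<close> is represented by the pair of the conjugacy class \<open>(H)\<close> and
  the connected component \<open>X\<^sub>H\<^sup>\<alpha>\<close>, the latter being a set of orbits.\<close>

type_synonym 'd topological_type = "(real^'d^'d) set set \<times> (real^'d) set set"

definition topological_types :: "(real^'d^'d) set \<Rightarrow> 'd::finite topological_type set" where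
  "topological_types G =
     {(conj_class G H, A) | H A. H \<subseteq> G \<and> orthogonal_subgroup H \<and>
        A \<in> connected_components_of (subtopology (orbit_space G) (orbits_of_type G H))}"

text \<open>A formal finite sum with coefficients in the natural numbers is a multiset.\<close>

definition topological_Burnside_types ::
    "(real^'d^'d) set \<Rightarrow> 'd::finite topological_type multiset set" where
  "topological_Burnside_types G = {\<Gamma>. set_mset \<Gamma> \<subseteq> topological_types G}"

definition has_Burnside_type ::
    "(real^'d^'d) set \<Rightarrow> 'd::finite config \<Rightarrow> 'd topological_type multiset \<Rightarrow> bool" where
  "has_Burnside_type G c \<Gamma> \<longleftrightarrow>
     (\<forall>(K, A)\<in>topological_types G. card (orbit G ` fst c \<inter> A) = count \<Gamma> (K, A))"


section \<open>Inertia spectrum\<close>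

definition charpoly :: "real^'d^'d \<Rightarrow> real poly" where
  "charpoly A = det (mat [:0, 1:] - (\<chi> i j. [:A $ i $ j:]))"

text \<open>Eigenvalues with multiplicity; only used for symmetric matrices, whose eigenvalues are
  all real.\<close>

definition spectrum :: "real^'d^'d \<Rightarrow> real multiset" where
  "spectrum A = proots (charpoly A)"

text \<open>This is \<open>X \<mu> X\<^sup>T\<close>; the sum over the points of \<open>C\<close> is the sum over the columns of \<open>X\<close>, see
  \<open>inertia_matrix_forget_order\<close> below.\<close>

definition inertia_matrix :: "'d::finite config \<Rightarrow> real^'d^'d" where
  "inertia_matrix = (\<lambda>(C, m). \<chi> i j. \<Sum>p\<in>C. p $ i * m p * p $ j)"

lemma inertia_matrix_forget_order:
  assumes "(x, m) \<in> ordered_configurations n"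
  shows "inertia_matrix (forget_order n (x, m)) = (\<chi> i j. \<Sum>k<n. x k $ i * m k * x k $ j)"
proof -
  have inj: "inj_on x {..<n}" using assms by (auto simp: ordered_configurations_def)
  show ?thesis
    unfolding inertia_matrix_def forget_order_def vec_eq_iff using inj
    by (auto simp: sum.reindex the_inv_into_f_f intro!: sum.cong)
qed

definition inertia_spectrum :: "'d::finite config \<Rightarrow> real multiset" where
  "inertia_spectrum c = spectrum (inertia_matrix c)"

definition configs_with_spectrum :: "nat \<Rightarrow> real multiset \<Rightarrow> 'd::finite config set" where
  "configs_with_spectrum n \<sigma> = {c \<in> configurations n. inertia_spectrum c = \<sigma>}"

definition symmetric_configs_with_spectrum ::
    "(real^'d^'d) set \<Rightarrow> nat \<Rightarrow> real multiset \<Rightarrow> 'd::finite config set" where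
  "symmetric_configs_with_spectrum G n \<sigma> =
     {c \<in> configs_with_spectrum n \<sigma>. symmetric_config G c}"

definition symmetric_configs_of_type ::
    "(real^'d^'d) set \<Rightarrow> nat \<Rightarrow> real multiset \<Rightarrow> 'd topological_type multiset
       \<Rightarrow> 'd::finite config set" where
  "symmetric_configs_of_type G n \<sigma> \<Gamma> =
     {c \<in> symmetric_configs_with_spectrum G n \<sigma>. has_Burnside_type G c \<Gamma>}"


section \<open>Balanced configurations\<close>

text \<open>Summing over ordered pairs counts each unordered pair twice.\<close>

definition potential :: "'d::finite config \<Rightarrow> real" where
  "potential = (\<lambda>(C, m).
     (\<Sum>(x, y)\<in>{(x, y). x \<in> C \<and> y \<in> C \<and> x \<noteq> y}. m x * m y / norm (x - y)) / 2)"

text \<open>Critical points of the restriction of \<open>F\<close> to a submanifold \<open>M\<close> of the configuration space: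
  the differential of \<open>F\<close> vanishes on the tangent space of \<open>M\<close>, i.e. \<open>F\<close> has derivative zero
  along every \<open>C\<^sup>1\<close> curve in \<open>M\<close> through the point. The smooth structure is that of ordered
  configurations, where the masses are constant along curves.\<close>

definition critical_point ::
    "nat \<Rightarrow> 'd::finite config set \<Rightarrow> ('d config \<Rightarrow> real) \<Rightarrow> 'd config \<Rightarrow> bool" where
  "critical_point n M F c \<longleftrightarrow> c \<in> M \<and>
     (\<forall>m \<gamma> \<epsilon>. 0 < \<epsilon> \<longrightarrow>
        (\<forall>t\<in>{-\<epsilon><..<\<epsilon>}. (\<gamma> t, m) \<in> ordered_configurations n \<and> forget_order n (\<gamma> t, m) \<in> M) \<longrightarrow>
        forget_order n (\<gamma> 0, m) = c \<longrightarrow>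
        (\<forall>i<n. (\<lambda>t. \<gamma> t i) C1_differentiable_on {-\<epsilon><..<\<epsilon>}) \<longrightarrow>
        ((\<lambda>t. F (forget_order n (\<gamma> t, m))) has_real_derivative 0) (at 0))"

definition balanced :: "nat \<Rightarrow> 'd::finite config \<Rightarrow> bool" where
  "balanced n c \<longleftrightarrow> critical_point n (configs_with_spectrum n (inertia_spectrum c)) potential c"

end

theory Submission
  imports Defs
begin

text \<open>
  Write \<open>X\<close> for the matrix whose columns are the positions \<open>x\<^sub>j\<close>, \<open>\<mu>\<close> for the diagonal matrix of the masses
  and \<open>S = X \<mu> X\<^sup>T\<close>. With the masses fixed, the inertia spectrum bounds the positions, and a bound on the
  potential \<open>U\<close> keeps the points apart, so \<open>U\<close> attains its minimum on every nonempty closed set of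
  configurations that has constant spectrum (\<open>potential_attains_minimum\<close>). A connected component \<open>K\<close> of
  \<open>\<C>(\<sigma>)\<^sup>G\<close> is such a set. It remains to see that a minimiser on \<open>K\<close>, which is a priori critical only
  among symmetric configurations, is critical on the whole of \<open>\<C>(\<sigma>)\<close>.

  Let \<open>a\<^sub>j\<close> be defined by \<open>dU(v) = - \<Sum>\<^sub>j m\<^sub>j \<langle>a\<^sub>j, v\<^sub>j\<rangle>\<close>, and write \<open>a\<close> for the matrix with these columns. With
  the masses fixed, \<open>\<C>(\<sigma>)\<close> is, apart from collisions, an orbit of rotations of \<open>\<real>\<^sup>d\<close> acting on \<open>X\<close> from the left and
  of isometries of the mass-weighted \<open>\<real>\<^sup>n\<close> acting from the right. So criticality splits into two
  symmetry conditions. Orthogonality to the left action says that \<open>a \<mu> X\<^sup>T\<close> is symmetric; it always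
  holds, because \<open>U\<close> is rotation invariant (\<open>repulsion_torque_symmetric\<close>). Orthogonality to the right
  action says that \<open>a\<^sup>T X\<close> is symmetric, so its obstruction is the skew matrix
  \<open>b\<^sub>j\<^sub>i = \<langle>a\<^sub>j, x\<^sub>i\<rangle> - \<langle>a\<^sub>i, x\<^sub>j\<rangle>\<close>. But this \<open>b\<close> is itself the generator of an admissible motion: the linear
  flow \<open>z\<^sub>j' = \<Sum>\<^sub>i m\<^sub>i b\<^sub>j\<^sub>i z\<^sub>i\<close> keeps \<open>S\<close> constant as \<open>b\<close> is skew, keeps the centre of mass as the total force
  is zero, and keeps the symmetry as \<open>a\<close> is \<open>G\<close>-equivariant. Until a collision it therefore stays in \<open>K\<close>, and \<open>U\<close>
  changes along it at the initial rate \<open>- 1/2 \<Sum>\<^sub>i\<^sub>j m\<^sub>i m\<^sub>j (b\<^sub>j\<^sub>i)\<^sup>2\<close>; minimality forces \<open>b = 0\<close>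
  (\<open>minimizer_repulsion_symmetric\<close>). This is the principle of symmetric criticality, with the gradient
  direction taking the place of an average over the group.

  The two symmetry conditions must then give \<open>dU(v) = 0\<close> for the velocity \<open>v\<close> of every \<open>C\<^sup>1\<close> curve in
  \<open>\<C>(\<sigma>)\<close>. This is proved without a parametrisation of the orbit, by differentiating the polynomial
  identities that the constant spectrum imposes on \<open>S\<close> (\<open>isospectral_first_variation\<close>).

  Finally, since the points of a configuration are distinct, a nearby symmetric
  configuration is permuted by \<open>G\<close> in the same way and its points have the same stabilisers. Hence the
  topological Burnside type is locally constant on symmetric configurations
  (\<open>Burnside_type_constant_on_connected\<close>), each nonempty \<open>\<C>(\<sigma>)(\<Gamma>)\<close> contains a whole component of
  \<open>\<C>(\<sigma>)\<^sup>G\<close>, and the last claim follows from the one about components.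
\<close>

section \<open>The spectral theorem and the characteristic polynomial\<close>

text \<open>The eigenvector is a maximiser of the Rayleigh quotient on the unit sphere of the invariant
  subspace.\<close>

lemma self_adjoint_unit_eigenvector:
  fixes f :: "'a::euclidean_space \<Rightarrow> 'a"
  assumes lin: "linear f" and sa: "\<And>u v. f u \<bullet> v = u \<bullet> f v"
    and T: "subspace T" "f ` T \<subseteq> T" "T \<noteq> {0}"
  obtains w l where "w \<in> T" "norm w = 1" "f w = l *\<^sub>R w"
proof -
  define K where "K = T \<inter> sphere 0 1"
  obtain p where p: "p \<in> T" "p \<noteq> 0" using T(1,3) subspace_0 by blast
  have "p /\<^sub>R norm p \<in> K" using p T(1) by (auto simp: K_def subspace_scale)
  moreover have "compact K"
    unfolding K_def by (intro closed_Int_compact closed_subspace T) auto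
  moreover have "continuous_on K (\<lambda>w. w \<bullet> f w)"
    by (intro continuous_intros linear_continuous_on linear_conv_bounded_linear[THEN iffD1] lin)
  ultimately obtain w where w: "w \<in> K" and mx: "\<And>u. u \<in> K \<Longrightarrow> u \<bullet> f u \<le> w \<bullet> f w"
    using continuous_attains_sup[of K "\<lambda>w. w \<bullet> f w"] by blast
  define l where "l = w \<bullet> f w"
  have wT: "w \<in> T" and w1: "norm w = 1" using w by (auto simp: K_def)
  have ww: "w \<bullet> w = 1" using w1 by (simp add: norm_eq_1)
  have quad: "u \<bullet> f u \<le> l * (u \<bullet> u)" if "u \<in> T" for u
  proof (cases "u = 0")
    case False
    then have "u /\<^sub>R norm u \<in> K" using that T(1) by (auto simp: K_def subspace_scale)
    from mx[OF this] have "(u \<bullet> f u) / (norm u)^2 \<le> l"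
      using linear_scale[OF lin] by (simp add: l_def power2_eq_square divide_inverse mult.commute mult.left_commute)
    then show ?thesis using False by (simp add: field_simps power2_norm_eq_inner)
  qed (use linear_0[OF lin] in simp)
  define e where "e = f w - l *\<^sub>R w"
  have eT: "e \<in> T" using wT T by (auto simp: e_def intro!: subspace_diff subspace_scale)
  have ew: "e \<bullet> w = 0" by (simp add: e_def l_def inner_diff_left ww inner_commute[of "f w" w])
  have fe: "f w \<bullet> e = e \<bullet> e"
  proof -
    have "e \<bullet> e = f w \<bullet> e - l * (w \<bullet> e)" by (subst e_def) (simp add: inner_diff_left)
    then show ?thesis using ew by (simp add: inner_commute)
  qed
  \<comment> \<open>The maximum property of \<open>w\<close>, tested in the direction of the defect \<open>e\<close>.\<close>
  have ineq: "2 * s * (e \<bullet> e) \<le> s^2 * (l * (e \<bullet> e) - e \<bullet> f e)" for s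
  proof -
    have "w + s *\<^sub>R e \<in> T" using wT eT T(1) by (simp add: subspace_add subspace_scale)
    from quad[OF this] have "l + 2 * s * (f w \<bullet> e) + s^2 * (e \<bullet> f e) \<le> l * (1 + s^2 * (e \<bullet> e))"
      using sa[of w e] ew ww
      by (simp add: linear_add[OF lin] linear_scale[OF lin] inner_add_left inner_add_right l_def
          inner_commute algebra_simps power2_eq_square)
    then show ?thesis by (simp add: fe algebra_simps)
  qed
  have "e \<bullet> e = 0"
  proof (rule ccontr)
    assume ne: "e \<bullet> e \<noteq> 0"
    define c where "c = \<bar>l * (e \<bullet> e) - e \<bullet> f e\<bar> + 1"
    have c: "c > 0" "l * (e \<bullet> e) - e \<bullet> f e < c" by (auto simp: c_def)
    have ep: "e \<bullet> e > 0" using ne by simp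
    define s where "s = (e \<bullet> e) / c"
    have s: "s > 0" using ep c by (simp add: s_def)
    have "2 * s * (e \<bullet> e) \<le> s^2 * c"
      using ineq[of s] c(2) mult_left_mono[of "l * (e \<bullet> e) - e \<bullet> f e" c "s^2"] by simp
    also have "\<dots> = s * (e \<bullet> e)" using c by (simp add: s_def power2_eq_square)
    finally show False using s ep by (simp add: mult_less_0_iff)
  qed
  then have "f w = l *\<^sub>R w" by (simp add: e_def)
  with wT w1 that show ?thesis by blast
qed

text \<open>A largest orthonormal set of eigenvectors is a basis: its orthogonal complement is invariant,
  so a nonzero complement would contain another eigenvector.\<close>

lemma self_adjoint_orthonormal_eigenbasis:
  fixes f :: "real^'d \<Rightarrow> real^'d"
  assumes lin: "linear f" and sa: "\<And>u v. f u \<bullet> v = u \<bullet> f v"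
  obtains w :: "'d \<Rightarrow> real^'d" and l where
    "\<And>i j. w i \<bullet> w j = (if i = j then 1 else 0)"
    "\<And>i. f (w i) = l i *\<^sub>R w i"
    "\<And>x. x = (\<Sum>i\<in>UNIV. (x \<bullet> w i) *\<^sub>R w i)"
proof -
  define good where "good B \<longleftrightarrow> pairwise orthogonal B \<and>
    (\<forall>b\<in>B. norm b = 1 \<and> (\<exists>l. f b = l *\<^sub>R b))" for B :: "(real^'d) set"
  have ind: "independent B" if "good B" for B
    using that unfolding good_def by (intro pairwise_orthogonal_independent) auto
  have "\<exists>B. good B \<and> (\<forall>B'. good B' \<longrightarrow> card B' \<le> card B)"
  proof (rule ex_has_greatest_nat)
    show "good {}" by (simp add: good_def)
    show "\<forall>y. good y \<longrightarrow> card y < Suc DIM(real^'d)"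
      using ind independent_card_le less_Suc_eq_le by blast
  qed
  then obtain B where B: "good B" and mx: "\<And>B'. good B' \<Longrightarrow> card B' \<le> card B" by blast
  have fin: "finite B" using ind[OF B] independent_bound by blast
  define T where "T = {x. \<forall>b\<in>B. x \<bullet> b = 0}"
  have "subspace T" by (auto simp: T_def subspace_def inner_add_left)
  moreover have "f ` T \<subseteq> T"
  proof clarify
    fix x assume x: "x \<in> T"
    show "f x \<in> T" unfolding T_def
    proof clarify
      fix b assume b: "b \<in> B"
      then obtain l where "f b = l *\<^sub>R b" using B by (auto simp: good_def)
      then show "f x \<bullet> b = 0" using x b by (simp add: sa T_def)
    qed
  qed
  ultimately have T0: "T = {0}"
  proof (rule_tac ccontr)
    assume sub: "subspace T" "f ` T \<subseteq> T" "T \<noteq> {0}"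
    then obtain w l where w: "w \<in> T" "norm w = 1" "f w = l *\<^sub>R w"
      using self_adjoint_unit_eigenvector[OF lin sa] by blast
    have "w \<notin> B" using w by (auto simp: T_def)
    moreover have "good (insert w B)"
      using B w unfolding good_def
      by (auto simp: pairwise_insert orthogonal_def T_def inner_commute)
    ultimately show False using mx[of "insert w B"] fin by simp
  qed
  have bb: "b \<bullet> c = (if b = c then 1 else 0)" if "b \<in> B" "c \<in> B" for b c
    using B that unfolding good_def pairwise_def orthogonal_def by (auto simp: norm_eq_1)
  have expand: "x = (\<Sum>b\<in>B. (x \<bullet> b) *\<^sub>R b)" for x
  proof -
    have "(\<Sum>b\<in>B. (x \<bullet> b) *\<^sub>R b) \<bullet> c = x \<bullet> c" if "c \<in> B" for c
    proof -
      have "(\<Sum>b\<in>B. (x \<bullet> b) *\<^sub>R b) \<bullet> c = (\<Sum>b\<in>B. if b = c then x \<bullet> b else 0)"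
        unfolding inner_sum_left using that by (intro sum.cong) (auto simp: bb)
      then show ?thesis using fin that by simp
    qed
    then have "x - (\<Sum>b\<in>B. (x \<bullet> b) *\<^sub>R b) \<in> T" by (simp add: T_def inner_diff_left)
    then show ?thesis using T0 by simp
  qed
  have "card B = CARD('d)"
  proof -
    have "x \<in> span B" for x
      by (subst expand) (intro span_sum span_scale span_base)
    then have "span B = UNIV" by auto
    then show ?thesis using ind[OF B] dim_span_eq_card_independent[of B] by simp
  qed
  then obtain w where w: "bij_betw w (UNIV :: 'd set) B"
    using finite_same_card_bij[of "UNIV :: 'd set" B] fin by auto
  then have wB: "w i \<in> B" and inj: "inj w" for i by (auto simp: bij_betw_def)
  have "\<forall>i. \<exists>l. f (w i) = l *\<^sub>R w i" using wB B by (auto simp: good_def)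
  then obtain l where l: "\<And>i. f (w i) = l i *\<^sub>R w i" by metis
  have "w i \<bullet> w j = (if i = j then 1 else 0)" for i j
    using bb[OF wB wB] inj by (auto simp: inj_eq)
  moreover have "x = (\<Sum>i\<in>UNIV. (x \<bullet> w i) *\<^sub>R w i)" for x
    using expand[of x] sum.reindex_bij_betw[OF w, of "\<lambda>b. (x \<bullet> b) *\<^sub>R b"] by simp
  ultimately show ?thesis using l that by blast
qed

lemma symmetric_matrix_orthonormal_eigenbasis:
  fixes A :: "real^'d^'d"
  assumes "transpose A = A"
  obtains w :: "'d \<Rightarrow> real^'d" and l where
    "\<And>i j. w i \<bullet> w j = (if i = j then 1 else 0)"
    "\<And>i. A *v w i = l i *\<^sub>R w i"
    "\<And>x. x = (\<Sum>i\<in>UNIV. (x \<bullet> w i) *\<^sub>R w i)"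
proof -
  have "(A *v u) \<bullet> v = u \<bullet> (A *v v)" for u v
    by (metis assms dot_lmul_matrix vector_transpose_matrix)
  then show ?thesis
    using self_adjoint_orthonormal_eigenbasis[OF matrix_vector_mul_linear, of A] that by blast
qed

lemma poly_det: "poly (det M) z = det (\<chi> i j. poly (M $ i $ j) z)"
proof -
  have "poly (of_int (sign p)) z = of_int (sign p)" for p :: "'b \<Rightarrow> 'b"
    by (simp add: sign_def)
  then show ?thesis by (simp add: det_def poly_sum poly_prod)
qed

lemma poly_charpoly: "poly (charpoly A) z = det (mat z - A)"
proof -
  have "(\<chi> i j. poly ((mat [:0, 1:] - (\<chi> i j. [:A $ i $ j:])) $ i $ j) z) = mat z - A"
    by (simp add: vec_eq_iff mat_def)
  then show ?thesis by (simp only: charpoly_def poly_det)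
qed

lemma charpoly_eigenbasis:
  fixes A :: "real^'d^'d" and w :: "'d \<Rightarrow> real^'d"
  assumes orth: "\<And>i j. w i \<bullet> w j = (if i = j then 1 else 0)"
    and eig: "\<And>i. A *v w i = l i *\<^sub>R w i"
  shows "charpoly A = (\<Prod>i\<in>UNIV. [:- l i, 1:])"
proof -
  have "poly (charpoly A) z = poly (\<Prod>i\<in>UNIV. [:- l i, 1:]) z" for z
  proof -
    define R :: "real^'d^'d" where "R = (\<chi> i j. w i $ j)"
    define D :: "real^'d^'d" where "D = (\<chi> i j. if i = j then z - l i else 0)"
    have RR: "R ** transpose R = mat 1"
      using orth by (simp add: R_def matrix_matrix_mult_def transpose_def vec_eq_iff mat_def inner_vec_def)
    have matz: "mat z *v x = z *\<^sub>R x" for x :: "real^'d"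
      by (simp add: matrix_vector_mult_def mat_def vec_eq_iff if_distrib[of "\<lambda>y. y * _"] cong: if_cong)
    have "R ** (mat z - A) ** transpose R = D"
    proof -
      have "(R ** ((mat z - A) ** transpose R)) $ i $ j = D $ i $ j" for i j
      proof -
        have "((mat z - A) ** transpose R) $ k $ j = ((mat z - A) *v w j) $ k" for k
          by (simp add: matrix_matrix_mult_def matrix_vector_mult_def transpose_def R_def)
        moreover have "(mat z - A) *v w j = (z - l j) *\<^sub>R w j"
          by (simp add: matrix_vector_mult_diff_rdistrib matz eig scaleR_diff_left)
        ultimately have "(R ** ((mat z - A) ** transpose R)) $ i $ j = (\<Sum>k\<in>UNIV. w i $ k * ((z - l j) * w j $ k))"
          by (subst matrix_matrix_mult_def) (simp add: R_def)
        also have "\<dots> = (z - l j) * (w i \<bullet> w j)"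
          by (simp add: inner_vec_def sum_distrib_left algebra_simps)
        finally show ?thesis by (simp add: orth D_def)
      qed
      then show ?thesis by (simp add: vec_eq_iff matrix_mul_assoc)
    qed
    then have "det D = det R * det (mat z - A) * det (transpose R)"
      by (metis det_mul)
    moreover have "det R * det (transpose R) = 1"
      using RR by (metis det_mul det_I)
    moreover have "det D = (\<Prod>i\<in>UNIV. z - l i)"
      by (subst det_diagonal) (auto simp: D_def)
    ultimately show ?thesis
      by (simp add: poly_charpoly poly_prod algebra_simps)
  qed
  then show ?thesis by (simp flip: poly_eq_poly_eq_iff add: fun_eq_iff)
qed

lemma spectrum_eigenbasis:
  fixes A :: "real^'d^'d" and w :: "'d \<Rightarrow> real^'d"
  assumes "\<And>i j. w i \<bullet> w j = (if i = j then 1 else 0)"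
    and "\<And>i. A *v w i = l i *\<^sub>R w i"
  shows "spectrum A = image_mset l (mset_set UNIV)"
proof -
  have "proots [:- c, 1:] = {#c#}" for c :: real
    using proots_linear_factor[of "-c"] by simp
  then show ?thesis
    unfolding spectrum_def charpoly_eigenbasis[OF assms]
    by (subst proots_prod) (auto simp: sum_unfold_sum_mset)
qed

text \<open>The characteristic polynomial of a symmetric matrix splits over the reals, so it is recovered
  from its roots.\<close>

lemma symmetric_spectrum_eq_iff:
  fixes A B :: "real^'d^'d"
  assumes "transpose A = A" "transpose B = B"
  shows "spectrum A = spectrum B \<longleftrightarrow> charpoly A = charpoly B"
proof
  have split: "charpoly A = prod_mset (image_mset (\<lambda>c. [:- c, 1:]) (spectrum A))"
    if A: "transpose A = A" for A :: "real^'d^'d"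
  proof -
    obtain w :: "'d \<Rightarrow> real^'d" and l where w: "\<And>i j. w i \<bullet> w j = (if i = j then 1 else 0)"
      "\<And>i. A *v w i = l i *\<^sub>R w i"
      using symmetric_matrix_orthonormal_eigenbasis[OF A] by metis
    show ?thesis
      unfolding spectrum_eigenbasis[OF w] charpoly_eigenbasis[OF w]
      by (simp add: prod_unfold_prod_mset image_mset.compositionality comp_def)
  qed
  show "charpoly A = charpoly B" if "spectrum A = spectrum B"
    using split assms that by metis
qed (simp add: spectrum_def)

lemma inner_orthonormal_expansion:
  fixes w :: "'i::finite \<Rightarrow> 'v::real_inner"
  assumes "\<And>x. x = (\<Sum>i\<in>UNIV. (x \<bullet> w i) *\<^sub>R w i)"
  shows "x \<bullet> y = (\<Sum>i\<in>UNIV. (x \<bullet> w i) * (y \<bullet> w i))"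
proof -
  have "x \<bullet> y = (\<Sum>i\<in>UNIV. (x \<bullet> w i) *\<^sub>R w i) \<bullet> y"
    by (rule arg_cong[OF assms])
  then show ?thesis by (simp only: inner_sum_left inner_scaleR_left inner_commute[of y])
qed

text \<open>The upper eigenvalue bound is what turns a prescribed inertia spectrum into a bound on the
  positions.\<close>

lemma symmetric_quadratic_form_le:
  fixes A :: "real^'d^'d"
  assumes A: "transpose A = A" and b: "\<And>c. c \<in># spectrum A \<Longrightarrow> c \<le> b"
  shows "x \<bullet> (A *v x) \<le> b * (x \<bullet> x)"
proof -
  obtain w :: "'d \<Rightarrow> real^'d" and l where w: "\<And>i j. w i \<bullet> w j = (if i = j then 1 else 0)"
    "\<And>i. A *v w i = l i *\<^sub>R w i" "\<And>x. x = (\<Sum>i\<in>UNIV. (x \<bullet> w i) *\<^sub>R w i)"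
    using symmetric_matrix_orthonormal_eigenbasis[OF A] by blast
  note inn = inner_orthonormal_expansion[of w, OF w(3)]
  have "(A *v x) \<bullet> w i = l i * (x \<bullet> w i)" for i
    by (metis A dot_lmul_matrix inner_scaleR_right vector_transpose_matrix w(2))
  then have "x \<bullet> (A *v x) = (\<Sum>i\<in>UNIV. l i * (x \<bullet> w i)^2)"
    by (subst inn) (simp add: power2_eq_square algebra_simps)
  also have "\<dots> \<le> (\<Sum>i\<in>UNIV. b * (x \<bullet> w i)^2)"
    by (intro sum_mono mult_right_mono b) (auto simp: spectrum_eigenbasis[OF w(1,2)])
  also have "\<dots> = b * (x \<bullet> x)"
    by (subst inn) (simp add: power2_eq_square sum_distrib_left)
  finally show ?thesis .
qed


section \<open>First variation along isospectral curves\<close>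

text \<open>The value at \<open>f\<close> of the polynomial with the list of roots \<open>L\<close>, that is \<open>\<Prod>\<^sub>l (f - l)\<close>, applied to \<open>p\<close>;
  \<open>shift_value c L\<close> and \<open>shift_deriv c L\<close> below are the value and the derivative of the same polynomial
  at the number \<open>c\<close>.\<close>

primrec shifts :: "('v::real_inner \<Rightarrow> 'v) \<Rightarrow> real list \<Rightarrow> 'v \<Rightarrow> 'v" where
  "shifts f [] p = p"
| "shifts f (l # L) p = f (shifts f L p) - l *\<^sub>R shifts f L p"

abbreviation shift_value :: "real \<Rightarrow> real list \<Rightarrow> real" where
  "shift_value c L \<equiv> prod_list (map (\<lambda>l. c - l) L)"

primrec shift_deriv :: "real \<Rightarrow> real list \<Rightarrow> real" where
  "shift_deriv c [] = 0"
| "shift_deriv c (l # L) = shift_value c L + (c - l) * shift_deriv c L"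

lemma shift_value_eq_0_iff: "shift_value c L = 0 \<longleftrightarrow> c \<in> set L"
  by (induction L) auto

lemma shift_deriv_simple_root:
  assumes "distinct L" "c \<in> set L"
  shows "shift_deriv c L \<noteq> 0"
  using assms
proof (induction L)
  case (Cons l L)
  show ?case
  proof (cases "l = c")
    case False
    then have "shift_value c L = 0" using Cons.prems by (simp add: shift_value_eq_0_iff)
    then show ?thesis using Cons False by auto
  qed (use Cons.prems in \<open>simp add: shift_value_eq_0_iff\<close>)
qed simp

lemma shifts_eigenvector:
  assumes "linear f" "f w = c *\<^sub>R w"
  shows "shifts f L w = shift_value c L *\<^sub>R w"
  by (induction L) (use assms in \<open>auto simp: linear_scale algebra_simps\<close>)

lemma inner_eigenvector_shifts:
  assumes "\<And>u v. f u \<bullet> v = u \<bullet> f v" "f w = c *\<^sub>R w"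
  shows "w \<bullet> shifts f L p = shift_value c L * (w \<bullet> p)"
proof (induction L)
  case (Cons l L)
  have "w \<bullet> f y = c * (w \<bullet> y)" for y using assms by (metis inner_scaleR_left)
  with Cons show ?case by (simp add: inner_diff_right algebra_simps)
qed simp

text \<open>In the product rule for \<open>\<Prod>\<^sub>l (f - l)\<close> the factors do not commute with the derivative of \<open>f\<close>.
  Between two eigenvectors for the same eigenvalue \<open>c\<close>, however, all factors to the left and to the right of
  the differentiated one act as numbers, and the scalar derivative at \<open>c\<close> comes out.\<close>

lemma shifts_has_derivative_between_eigenvectors:
  fixes f :: "real \<Rightarrow> 'v::real_inner \<Rightarrow> 'v"
  assumes der: "\<And>y y'. (y has_vector_derivative y') (at 0) \<Longrightarrow>
      ((\<lambda>t. f t (y t)) has_vector_derivative f' (y 0) + f 0 y') (at 0)"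
    and lin: "linear (f 0)" "linear f'" and sa: "\<And>u v. f 0 u \<bullet> v = u \<bullet> f 0 v"
    and w: "f 0 w = c *\<^sub>R w" and p0: "f 0 (p 0) = c *\<^sub>R p 0"
    and p: "(p has_vector_derivative p') (at 0)"
  shows "\<exists>D. ((\<lambda>t. shifts (f t) L (p t)) has_vector_derivative D) (at 0) \<and>
    w \<bullet> D = shift_deriv c L * (w \<bullet> f' (p 0)) + shift_value c L * (w \<bullet> p')"
proof (induction L)
  case (Cons l L)
  then obtain D where D: "((\<lambda>t. shifts (f t) L (p t)) has_vector_derivative D) (at 0)"
    "w \<bullet> D = shift_deriv c L * (w \<bullet> f' (p 0)) + shift_value c L * (w \<bullet> p')" by blast
  have deriv: "((\<lambda>t. shifts (f t) (l # L) (p t)) has_vector_derivative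
      f' (shifts (f 0) L (p 0)) + f 0 D - l *\<^sub>R D) (at 0)"
    unfolding shifts.simps
    by (intro has_vector_derivative_diff der D(1) bounded_linear.has_vector_derivative[OF bounded_linear_scaleR_right])
  moreover have "w \<bullet> f 0 D = c * (w \<bullet> D)" using sa w by (metis inner_scaleR_left)
  ultimately have "w \<bullet> (f' (shifts (f 0) L (p 0)) + f 0 D - l *\<^sub>R D) =
      shift_deriv c (l # L) * (w \<bullet> f' (p 0)) + shift_value c (l # L) * (w \<bullet> p')"
    using D(2) by (simp add: shifts_eigenvector[OF lin(1) p0] linear_scale[OF lin(2)] inner_add_right
        inner_diff_right algebra_simps)
  with deriv show ?case by blast
qed (use p in auto)

definition inertia_operator :: "nat \<Rightarrow> (nat \<Rightarrow> real) \<Rightarrow> (nat \<Rightarrow> real^'d) \<Rightarrow> real^'d \<Rightarrow> real^'d" where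
  "inertia_operator n m x p = (\<Sum>j<n. (m j * (x j \<bullet> p)) *\<^sub>R x j)"

definition gram_matrix :: "nat \<Rightarrow> (nat \<Rightarrow> real) \<Rightarrow> (nat \<Rightarrow> real^'d) \<Rightarrow> real^'d^'d" where
  "gram_matrix n m x = (\<chi> a b. \<Sum>k<n. x k $ a * m k * x k $ b)"

lemma transpose_gram_matrix [simp]: "transpose (gram_matrix n m x) = gram_matrix n m x"
  by (simp add: gram_matrix_def transpose_def vec_eq_iff algebra_simps)

lemma gram_matrix_mult: "gram_matrix n m x *v p = inertia_operator n m x p"
proof -
  have "(\<Sum>b\<in>UNIV. (\<Sum>k<n. x k $ a * m k * x k $ b) * p $ b) =
      (\<Sum>k<n. m k * (\<Sum>b\<in>UNIV. x k $ b * p $ b) * x k $ a)" for a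
    unfolding sum_distrib_right sum_distrib_left
    by (subst sum.swap) (simp add: algebra_simps)
  then show ?thesis
    by (simp add: vec_eq_iff gram_matrix_def inertia_operator_def matrix_vector_mult_def inner_vec_def)
qed

lemma linear_inertia_operator: "linear (inertia_operator n m x)"
  by (rule linearI) (simp_all add: inertia_operator_def inner_add_right algebra_simps sum.distrib
      scaleR_sum_right)

lemma inertia_operator_inner:
  "inertia_operator n m x p \<bullet> q = (\<Sum>j<n. m j * (x j \<bullet> p) * (x j \<bullet> q))"
  by (simp add: inertia_operator_def inner_sum_left)

lemma inertia_operator_self_adjoint:
  "inertia_operator n m x p \<bullet> q = p \<bullet> inertia_operator n m x q"
  by (simp add: inertia_operator_inner inner_commute[of p] algebra_simps)

lemma inertia_operator_kernel:
  assumes m: "\<And>j. j < n \<Longrightarrow> m j > 0" and w: "inertia_operator n m x w = 0" and j: "j < n"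
  shows "x j \<bullet> w = 0"
proof -
  have "(\<Sum>j<n. m j * (x j \<bullet> w)^2) = 0"
    using inertia_operator_inner[of n m x w w] w by (simp add: power2_eq_square algebra_simps)
  then have "m j * (x j \<bullet> w)^2 = 0"
    using j m by (subst (asm) sum_nonneg_eq_0_iff) (auto simp: less_imp_le)
  then show ?thesis using m[OF j] by simp
qed

lemma inertia_operator_eigenbasis:
  obtains w :: "'d \<Rightarrow> real^'d" and l where
    "\<And>i j. w i \<bullet> w j = (if i = j then 1 else 0)"
    "\<And>i. inertia_operator n m x (w i) = l i *\<^sub>R w i"
    "\<And>u v. u \<bullet> v = (\<Sum>i\<in>UNIV. (u \<bullet> w i) * (v \<bullet> w i))"
    "\<And>i. l i \<in># spectrum (gram_matrix n m x)"
proof -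
  obtain w :: "'d \<Rightarrow> real^'d" and l where w: "\<And>i j. w i \<bullet> w j = (if i = j then 1 else 0)"
    "\<And>i. gram_matrix n m x *v w i = l i *\<^sub>R w i" "\<And>x. x = (\<Sum>i\<in>UNIV. (x \<bullet> w i) *\<^sub>R w i)"
    using symmetric_matrix_orthonormal_eigenbasis[OF transpose_gram_matrix[of n m x]] by blast
  note inner_orthonormal_expansion[of w, OF w(3)]
  moreover have "l i \<in># spectrum (gram_matrix n m x)" for i
    by (simp add: spectrum_eigenbasis[OF w(1,2)])
  ultimately show ?thesis
    using that w(1) w(2)[unfolded gram_matrix_mult] by blast
qed

text \<open>A component of \<open>x\<^sub>j\<close> along an eigenvector with nonzero eigenvalue is removed by one of the factors,
  and there is no component along the kernel. The eigenvalue \<open>0\<close> may thus be left out of \<open>L\<close>. For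
  singular \<open>S\<close> this says more than the vanishing of the minimal polynomial at \<open>S\<close>, and that surplus controls
  the motion of the points in the direction of the kernel.\<close>

lemma shifts_inertia_operator_position:
  fixes x :: "nat \<Rightarrow> real^'d"
  assumes m: "\<And>j. j < n \<Longrightarrow> m j > 0"
    and L: "\<And>c. c \<in># spectrum (gram_matrix n m x) \<Longrightarrow> c \<noteq> 0 \<Longrightarrow> c \<in> set L"
    and j: "j < n"
  shows "shifts (inertia_operator n m x) L (x j) = 0"
proof -
  let ?S = "inertia_operator n m x"
  obtain w :: "'d \<Rightarrow> real^'d" and l where w: "\<And>i j. w i \<bullet> w j = (if i = j then 1 else 0)"
    "\<And>i. ?S (w i) = l i *\<^sub>R w i" "\<And>u v. u \<bullet> v = (\<Sum>i\<in>UNIV. (u \<bullet> w i) * (v \<bullet> w i))"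
    "\<And>i. l i \<in># spectrum (gram_matrix n m x)"
    using inertia_operator_eigenbasis[of n m x] by blast
  have "w i \<bullet> shifts ?S L (x j) = 0" for i
  proof (cases "l i = 0")
    case True
    then have "x j \<bullet> w i = 0" using w(2)[of i] inertia_operator_kernel[OF m _ j] by simp
    then show ?thesis
      by (simp add: inner_eigenvector_shifts[OF inertia_operator_self_adjoint w(2)] inner_commute)
  next
    case False
    then have "shift_value (l i) L = 0" using L w(4)[of i] by (auto simp: shift_value_eq_0_iff)
    then show ?thesis
      by (simp add: inner_eigenvector_shifts[OF inertia_operator_self_adjoint w(2)])
  qed
  then have "shifts ?S L (x j) \<bullet> shifts ?S L (x j) = 0"
    by (subst w(3)) (simp add: inner_commute)
  then show ?thesis by simp
qed

lemma shifts_linear: "linear f \<Longrightarrow> linear (shifts f L)"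
proof (induction L)
  case (Cons l L)
  then have "linear (f \<circ> shifts f L)" "linear (\<lambda>p. l *\<^sub>R shifts f L p)"
    by (auto intro: linear_compose linear_compose_scale_right)
  then show ?case using linear_compose_sub[of "f \<circ> shifts f L"] by (simp add: comp_def)
qed (auto simp: linear_iff)

text \<open>Let \<open>S\<close> be the inertia operator, \<open>S'\<close> its derivative and \<open>w\<^sub>i\<close> an orthonormal eigenbasis of \<open>S(0)\<close>. Let
  \<open>L\<close> consist of the nonzero eigenvalues. The product over \<open>L\<close> annihilates the range of \<open>S(t)\<close> for
  all \<open>t\<close>, and differentiation of this identity gives \<open>\<langle>w\<^sub>i, S' w\<^sub>k\<rangle> = 0\<close> whenever \<open>w\<^sub>i\<close> and \<open>w\<^sub>k\<close> have the same
  nonzero eigenvalue, as the roots in \<open>L\<close> are simple; in the kernel the same holds directly.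

  By the second symmetry hypothesis \<open>M = X \<mu> a\<^sup>T\<close> is symmetric. By the first, \<open>S a\<^sub>j = M x\<^sub>j\<close>, whence
  \<open>M\<close> commutes with \<open>S\<close>. The part of the sum outside the kernel then becomes a trace of \<open>S'\<close> against
  an operator that respects the eigenspaces, so it is zero by the above. The part in the kernel is zero because
  the product over \<open>L\<close> annihilates the positions \<open>x\<^sub>j(t)\<close> themselves.\<close>

lemma isospectral_first_variation:
  fixes x :: "real \<Rightarrow> nat \<Rightarrow> real^'d" and a v :: "nat \<Rightarrow> real^'d"
  assumes m: "\<And>j. j < n \<Longrightarrow> m j > 0"
    and der: "\<And>j. j < n \<Longrightarrow> ((\<lambda>t. x t j) has_vector_derivative v j) (at 0)"
    and e: "e > 0" and spec: "\<And>t. \<bar>t\<bar> < e \<Longrightarrow> spectrum (gram_matrix n m (x t)) = \<sigma>"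
    and sym1: "\<And>i j. i < n \<Longrightarrow> j < n \<Longrightarrow> a j \<bullet> x 0 i = a i \<bullet> x 0 j"
    and sym2: "\<And>p q. (\<Sum>j<n. m j * (a j \<bullet> p) * (x 0 j \<bullet> q)) = (\<Sum>j<n. m j * (a j \<bullet> q) * (x 0 j \<bullet> p))"
  shows "(\<Sum>j<n. m j * (a j \<bullet> v j)) = 0"
proof -
  define S where "S t = inertia_operator n m (x t)" for t
  define S' where "S' p = (\<Sum>j<n. (m j * (x 0 j \<bullet> p)) *\<^sub>R v j + (m j * (v j \<bullet> p)) *\<^sub>R x 0 j)" for p
  define M where "M p = (\<Sum>j<n. (m j * (a j \<bullet> p)) *\<^sub>R x 0 j)" for p
  obtain L where L: "set L = {c. c \<in># \<sigma> \<and> c \<noteq> 0}" "distinct L"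
    using finite_distinct_list[of "{c. c \<in># \<sigma> \<and> c \<noteq> 0}"] by auto
  have linS: "linear (S t)" for t by (simp add: S_def linear_inertia_operator)
  have saS: "S t u \<bullet> w = u \<bullet> S t w" for t u w
    by (simp add: S_def inertia_operator_self_adjoint)
  have linS': "linear S'"
    by (rule linearI) (simp_all add: S'_def inner_add_right algebra_simps sum.distrib
      scaleR_sum_right)
  have derS: "((\<lambda>t. S t (y t)) has_vector_derivative S' (y 0) + S 0 y') (at 0)"
    if y: "(y has_vector_derivative y') (at 0)" for y y'
  proof -
    have "((\<lambda>t. (m j * (x t j \<bullet> y t)) *\<^sub>R x t j) has_vector_derivative
        ((m j * (x 0 j \<bullet> y 0)) *\<^sub>R v j + (m j * (v j \<bullet> y 0)) *\<^sub>R x 0 j) + (m j * (x 0 j \<bullet> y')) *\<^sub>R x 0 j) (at 0)"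
      if "j < n" for j
    proof -
      have "((\<lambda>t. m j * (x t j \<bullet> y t)) has_real_derivative m j * (x 0 j \<bullet> y' + v j \<bullet> y 0)) (at 0)"
        using bounded_bilinear.has_vector_derivative[OF bounded_bilinear_inner der[OF that] y]
        by (intro DERIV_cmult) (simp add: has_real_derivative_iff_has_vector_derivative)
      from has_vector_derivative_scaleR[OF this der[OF that]]
      show ?thesis by (simp add: algebra_simps)
    qed
    then have "((\<lambda>t. \<Sum>j<n. (m j * (x t j \<bullet> y t)) *\<^sub>R x t j) has_vector_derivative
        (\<Sum>j<n. ((m j * (x 0 j \<bullet> y 0)) *\<^sub>R v j + (m j * (v j \<bullet> y 0)) *\<^sub>R x 0 j) + (m j * (x 0 j \<bullet> y')) *\<^sub>R x 0 j)) (at 0)"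
      by (intro has_vector_derivative_sum) auto
    then show ?thesis by (simp add: S_def inertia_operator_def S'_def sum.distrib)
  qed
  have zero_deriv: "D = 0" if D: "(g has_vector_derivative D) (at 0)"
    and g: "\<And>t. \<bar>t\<bar> < e \<Longrightarrow> g t = 0" for g :: "real \<Rightarrow> real^'d" and D
  proof -
    have "((\<lambda>t. 0) has_vector_derivative D) (at (0::real))"
      by (rule has_vector_derivative_transform_within_open[OF D, of "{-e<..<e}"]) (use g e in auto)
    then show ?thesis using vector_derivative_unique_at[OF _ has_vector_derivative_const] by blast
  qed
  have kill: "shifts (S t) L (x t j) = 0" if "\<bar>t\<bar> < e" "j < n" for t j
    unfolding S_def by (rule shifts_inertia_operator_position[OF m _ that(2)]) (use spec[OF that(1)] L in auto)
  have kill_range: "shifts (S t) L (S t p) = 0" if "\<bar>t\<bar> < e" for t p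
  proof -
    have "shifts (S t) L (S t p) = (\<Sum>j<n. (m j * (x t j \<bullet> p)) *\<^sub>R shifts (S t) L (x t j))"
      using shifts_linear[OF linS[of t], of L]
      by (simp add: S_def inertia_operator_def linear_sum linear_scale)
    then show ?thesis using kill[OF that] by simp
  qed
  obtain w :: "'d \<Rightarrow> real^'d" and l where w: "\<And>i j. w i \<bullet> w j = (if i = j then 1 else 0)"
    "\<And>i. S 0 (w i) = l i *\<^sub>R w i" "\<And>u v. u \<bullet> v = (\<Sum>i\<in>UNIV. (u \<bullet> w i) * (v \<bullet> w i))"
    "\<And>i. l i \<in># spectrum (gram_matrix n m (x 0))"
    using inertia_operator_eigenbasis[of n m "x 0"] unfolding S_def by blast
  have lL: "l i \<in> set L" if "l i \<noteq> 0" for i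
    using w(4)[of i] spec[of 0] e that L by simp
  have S'_inner: "u \<bullet> S' p = (\<Sum>j<n. m j * (x 0 j \<bullet> p) * (v j \<bullet> u)) + (\<Sum>j<n. m j * (x 0 j \<bullet> u) * (v j \<bullet> p))" for u p
    by (simp add: S'_def inner_sum_right inner_add_right sum.distrib inner_commute[of u] algebra_simps)
  have ker: "x 0 j \<bullet> u = 0" if "S 0 u = 0" "j < n" for u j
    using inertia_operator_kernel[where x = "x 0" and w = u, OF m] that by (simp add: S_def)
  have S'_eig: "w i \<bullet> S' (w k) = 0" if same: "l i = l k" for i k
  proof (cases "l k = 0")
    case True
    then show ?thesis using ker w(2) same by (simp add: S'_inner)
  next
    case False
    let ?p = "\<lambda>t. S t (w k)"
    have p: "(?p has_vector_derivative S' (w k)) (at 0)"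
      using derS[OF has_vector_derivative_const[of "w k"]] linear_0[OF linS] by simp
    have p0: "S 0 (?p 0) = l k *\<^sub>R ?p 0" using linear_scale[OF linS] w(2) by simp
    obtain D where D: "((\<lambda>t. shifts (S t) L (?p t)) has_vector_derivative D) (at 0)"
      "w i \<bullet> D = shift_deriv (l k) L * (w i \<bullet> S' (?p 0)) + shift_value (l k) L * (w i \<bullet> S' (w k))"
      using shifts_has_derivative_between_eigenvectors[OF derS linS linS' saS w(2)[of i, unfolded same] p0 p]
      by blast
    have "D = 0" using zero_deriv[OF D(1)] kill_range by blast
    moreover have "shift_value (l k) L = 0" using lL[OF False] by (auto simp: shift_value_eq_0_iff)
    ultimately have "shift_deriv (l k) L * (l k * (w i \<bullet> S' (w k))) = 0"
      using D(2) w(2) linear_scale[OF linS'] by simp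
    then show ?thesis using shift_deriv_simple_root[OF L(2) lL[OF False]] False by simp
  qed
  have linM: "linear M"
    by (rule linearI) (simp_all add: M_def inner_add_right algebra_simps sum.distrib scaleR_sum_right)
  have M_inner: "M p \<bullet> q = (\<Sum>j<n. m j * (a j \<bullet> p) * (x 0 j \<bullet> q))" for p q
    by (simp add: M_def inner_sum_left)
  have M_sym: "M p \<bullet> q = p \<bullet> M q" for p q
    by (subst inner_commute[of p]) (simp only: M_inner sym2[of p q])
  have Sa: "S 0 (a j) = M (x 0 j)" if "j < n" for j
    using sym1[OF _ that] by (simp add: S_def inertia_operator_def M_def inner_commute)
  have SM: "S 0 (M p) = M (S 0 p)" for p
  proof (rule vector_eq_ldot[THEN iffD1], intro allI)
    fix q
    have "q \<bullet> S 0 (M p) = (\<Sum>j<n. m j * (a j \<bullet> p) * (x 0 j \<bullet> S 0 q))"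
      using M_inner saS by (metis inner_commute)
    also have "\<dots> = (\<Sum>j<n. m j * (x 0 j \<bullet> p) * (a j \<bullet> S 0 q))"
      using sym2[of p "S 0 q"] by (simp add: algebra_simps)
    also have "\<dots> = (\<Sum>j<n. m j * (x 0 j \<bullet> p) * (x 0 j \<bullet> M q))"
      by (intro sum.cong) (auto simp: saS[symmetric] Sa M_sym)
    also have "\<dots> = S 0 p \<bullet> M q" by (simp add: S_def inertia_operator_inner)
    finally show "q \<bullet> S 0 (M p) = q \<bullet> M (S 0 p)" by (simp add: M_sym inner_commute)
  qed
  have M_eig: "w i \<bullet> M (w k) = 0" if "l i \<noteq> l k" for i k
  proof -
    have "l i * (w i \<bullet> M (w k)) = l k * (w i \<bullet> M (w k))"
      using SM[of "w k"] saS[of 0 "w i" "M (w k)"] w(2) by (simp add: linear_scale[OF linM])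
    then show ?thesis using that by simp
  qed
  \<comment> \<open>\<open>\<beta>\<close> is the half of \<open>S'\<close> in which only the second factor is differentiated,
    and the \<open>\<kappa> i\<close> are the eigenvalues of the pseudo-inverse of \<open>S(0)\<close>.\<close>
  define \<beta> where "\<beta> p q = (\<Sum>j<n. m j * (x 0 j \<bullet> p) * (v j \<bullet> q))" for p q
  define \<kappa> where "\<kappa> i = (if l i = 0 then 0 else 1 / l i)" for i
  have \<beta>_sym: "\<beta> (w i) (w k) + \<beta> (w k) (w i) = 0" if "l i = l k" for i k
    using S'_eig[OF that] by (simp add: S'_inner \<beta>_def)
  have term_k: "(\<Sum>j<n. m j * ((a j \<bullet> w k) * (v j \<bullet> w k))) = \<kappa> k * \<beta> (M (w k)) (w k)" for k
  proof (cases "l k = 0")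
    case True
    \<comment> \<open>A curve in the span of the positions which at time \<open>0\<close> is at \<open>M w\<^sub>k\<close>, again in the kernel.\<close>
    let ?p = "\<lambda>t. \<Sum>j<n. (m j * (a j \<bullet> w k)) *\<^sub>R x t j"
    let ?p' = "\<Sum>j<n. (m j * (a j \<bullet> w k)) *\<^sub>R v j"
    have p: "(?p has_vector_derivative ?p') (at 0)"
      by (intro has_vector_derivative_sum bounded_linear.has_vector_derivative[OF bounded_linear_scaleR_right] der) auto
    have S0: "S 0 (w k) = 0" using w(2) True by simp
    have SM0: "S 0 (M (w k)) = 0" by (simp add: SM S0 linear_0[OF linM])
    then have p0: "S 0 (?p 0) = l k *\<^sub>R ?p 0" using True by (simp add: M_def)
    obtain D where D: "((\<lambda>t. shifts (S t) L (?p t)) has_vector_derivative D) (at 0)"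
      "w k \<bullet> D = shift_deriv (l k) L * (w k \<bullet> S' (?p 0)) + shift_value (l k) L * (w k \<bullet> ?p')"
      using shifts_has_derivative_between_eigenvectors[OF derS linS linS' saS w(2) p0 p]
      by blast
    have "shifts (S t) L (?p t) = 0" if "\<bar>t\<bar> < e" for t
      using kill[OF that] shifts_linear[OF linS[of t], of L] by (simp add: linear_sum linear_scale)
    then have "D = 0" using zero_deriv[OF D(1)] by blast
    moreover have "w k \<bullet> S' (?p 0) = 0"
      using ker[OF S0] ker[OF SM0] by (simp add: S'_inner flip: M_def)
    moreover have "shift_value (l k) L \<noteq> 0" unfolding shift_value_eq_0_iff using L True by simp
    ultimately have "w k \<bullet> ?p' = 0" using D(2) by simp
    then show ?thesis using True
      by (simp add: \<kappa>_def inner_sum_right inner_commute[of "w k" "v _"] mult.assoc)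
  next
    case False
    have "a j \<bullet> w k = \<kappa> k * (x 0 j \<bullet> M (w k))" if "j < n" for j
    proof -
      have "l k * (a j \<bullet> w k) = a j \<bullet> S 0 (w k)" by (simp add: w(2))
      also have "\<dots> = x 0 j \<bullet> M (w k)" by (simp add: saS[symmetric] Sa[OF that] M_sym)
      finally show ?thesis using False by (simp add: \<kappa>_def field_simps)
    qed
    then show ?thesis by (simp add: \<beta>_def sum_distrib_left algebra_simps)
  qed
  have \<beta>_expand: "\<beta> p q = (\<Sum>i\<in>UNIV. (w i \<bullet> p) * \<beta> (w i) q)" for p q
  proof -
    have "\<beta> p q = (\<Sum>j<n. \<Sum>i\<in>UNIV. m j * ((x 0 j \<bullet> w i) * (p \<bullet> w i)) * (v j \<bullet> q))"
      unfolding \<beta>_def by (subst w(3)) (simp add: sum_distrib_left sum_distrib_right)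
    then show ?thesis
      by (subst (asm) sum.swap) (simp add: \<beta>_def sum_distrib_left inner_commute[of _ p] algebra_simps)
  qed
  define T where "T k i = \<kappa> k * (w i \<bullet> M (w k)) * \<beta> (w i) (w k)" for k i
  \<comment> \<open>The entries of \<open>M\<close> between different eigenspaces vanish. Within one eigenspace \<open>\<kappa>\<close> is constant,
    \<open>M\<close> is symmetric and \<open>\<beta>\<close> is antisymmetric.\<close>
  have T_anti: "T k i + T i k = 0" for k i
  proof (cases "l i = l k")
    case True
    then have "\<kappa> i = \<kappa> k" by (simp add: \<kappa>_def)
    moreover have "w i \<bullet> M (w k) = w k \<bullet> M (w i)" by (metis M_sym inner_commute)
    ultimately show ?thesis using \<beta>_sym[OF True] by (simp add: T_def flip: distrib_left)
  next
    case False
    then show ?thesis using M_eig[of i k] M_eig[of k i] by (simp add: T_def)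
  qed
  have "(\<Sum>j<n. m j * (a j \<bullet> v j)) = (\<Sum>j<n. \<Sum>k\<in>UNIV. m j * ((a j \<bullet> w k) * (v j \<bullet> w k)))"
    by (subst w(3)) (simp add: sum_distrib_left)
  also have "\<dots> = (\<Sum>k\<in>UNIV. \<kappa> k * \<beta> (M (w k)) (w k))"
    by (subst sum.swap) (simp add: term_k)
  also have "\<dots> = (\<Sum>k\<in>UNIV. \<Sum>i\<in>UNIV. T k i)"
    by (subst \<beta>_expand) (simp add: T_def sum_distrib_left algebra_simps)
  finally have eq: "(\<Sum>j<n. m j * (a j \<bullet> v j)) = (\<Sum>k\<in>UNIV. \<Sum>i\<in>UNIV. T k i)" .
  moreover have "(\<Sum>k\<in>UNIV. \<Sum>i\<in>UNIV. T k i) + (\<Sum>k\<in>UNIV. \<Sum>i\<in>UNIV. T i k) = 0"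
    by (simp add: T_anti flip: sum.distrib)
  moreover have "(\<Sum>k\<in>UNIV. \<Sum>i\<in>UNIV. T i k) = (\<Sum>k\<in>UNIV. \<Sum>i\<in>UNIV. T k i)"
    by (rule sum.swap)
  ultimately show ?thesis by simp
qed

section \<open>Linear flows preserving a weighted inner product\<close>

text \<open>The power series of the matrix exponential, coordinate by coordinate.\<close>

lemma linear_system_solution_real:
  fixes B :: "nat \<Rightarrow> nat \<Rightarrow> real" and x0 :: "nat \<Rightarrow> real"
  obtains z where "\<And>j. z 0 j = x0 j"
    "\<And>t j. j < n \<Longrightarrow> ((\<lambda>t. z t j) has_real_derivative (\<Sum>i<n. B j i * z t i)) (at t)"
proof -
  define L where "L y j = (\<Sum>i<n. B j i * y i)" for y :: "nat \<Rightarrow> real" and j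
  define it where "it k = (L ^^ k) x0" for k
  define b where "b = (\<Sum>j<n. \<Sum>i<n. \<bar>B j i\<bar>)"
  define M where "M = (\<Sum>j<n. \<bar>x0 j\<bar>)"
  have b0: "b \<ge> 0" by (simp add: b_def sum_nonneg)
  have it_Suc: "it (Suc k) j = (\<Sum>i<n. B j i * it k i)" for k j by (simp add: it_def L_def)
  have bound: "\<bar>it k j\<bar> \<le> M * b ^ k" if "j < n" for k j
    using that
  proof (induction k arbitrary: j)
    case 0
    then show ?case unfolding it_def M_def by (auto intro!: member_le_sum)
  next
    case (Suc k)
    have "\<bar>it (Suc k) j\<bar> \<le> (\<Sum>i<n. \<bar>B j i\<bar> * \<bar>it k i\<bar>)"
      unfolding it_Suc by (rule order_trans[OF sum_abs]) (simp add: abs_mult)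
    also have "\<dots> \<le> (\<Sum>i<n. \<bar>B j i\<bar> * (M * b ^ k))"
      using Suc.IH by (intro sum_mono mult_left_mono) auto
    also have "\<dots> = (\<Sum>i<n. \<bar>B j i\<bar>) * (M * b ^ k)" by (simp add: sum_distrib_right)
    also have "\<dots> \<le> b * (M * b ^ k)"
      unfolding b_def using Suc.prems b0
      by (intro mult_right_mono member_le_sum[of j "{..<n}" "\<lambda>j. \<Sum>i<n. \<bar>B j i\<bar>"])
        (auto simp: M_def sum_nonneg zero_le_power)
    finally show ?case by (simp add: algebra_simps)
  qed
  define c where "c j k = it k j / fact k" for j k
  have summ: "summable (\<lambda>k. c j k * y ^ k)" if "j < n" for j y
  proof (rule summable_comparison_test')
    show "summable (\<lambda>k. M * (inverse (fact k) * (b * \<bar>y\<bar>) ^ k))"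
      by (intro summable_mult summable_exp)
    show "norm (c j k * y ^ k) \<le> M * (inverse (fact k) * (b * \<bar>y\<bar>) ^ k)" for k
    proof -
      have "norm (c j k * y ^ k) = \<bar>it k j\<bar> * (inverse (fact k) * \<bar>y\<bar> ^ k)"
        by (simp add: c_def abs_mult power_abs divide_inverse)
      also have "\<dots> \<le> (M * b ^ k) * (inverse (fact k) * \<bar>y\<bar> ^ k)"
        by (intro mult_right_mono bound[OF that]) auto
      finally show ?thesis by (simp add: power_mult_distrib algebra_simps)
    qed
  qed
  define z where "z t j = (if j < n then \<Sum>k. c j k * t ^ k else x0 j)" for t j
  have "z 0 j = x0 j" for j
    unfolding z_def powser_zero by (simp add: c_def it_def)
  moreover have "((\<lambda>t. z t j) has_real_derivative (\<Sum>i<n. B j i * z t i)) (at t)" if j: "j < n" for j t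
  proof -
    have "diffs (c j) k * t ^ k = (\<Sum>i<n. B j i * (c i k * t ^ k))" for k
      by (simp add: diffs_def c_def it_Suc sum_distrib_right sum_divide_distrib sum_distrib_left field_simps
          del: of_nat_Suc)
    then have "(\<Sum>k. diffs (c j) k * t ^ k) = (\<Sum>k. \<Sum>i<n. B j i * (c i k * t ^ k))" by simp
    also have "\<dots> = (\<Sum>i<n. \<Sum>k. B j i * (c i k * t ^ k))"
      by (rule suminf_sum) (auto intro: summable_mult summ)
    also have "\<dots> = (\<Sum>i<n. B j i * z t i)"
      by (intro sum.cong refl) (simp add: z_def suminf_mult summ)
    finally show ?thesis
      using termdiffs_strong_converges_everywhere[OF summ[OF j], of t] j by (simp add: z_def)
  qed
  ultimately show ?thesis using that by blast
qed

text \<open>For skew \<open>b\<close> the system \<open>z\<^sub>j' = \<Sum>\<^sub>i m\<^sub>i b\<^sub>j\<^sub>i z\<^sub>i\<close> acts on the matrix of positions from the right, by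
  infinitesimal isometries of \<open>\<real>\<^sup>n\<close> with the inner product \<open>\<Sum>\<^sub>j m\<^sub>j y\<^sub>j z\<^sub>j\<close>. Anything linear that is done to the
  points of \<open>\<real>\<^sup>d\<close> commutes with it.\<close>

definition flows_by :: "nat \<Rightarrow> (nat \<Rightarrow> real) \<Rightarrow> (nat \<Rightarrow> nat \<Rightarrow> real) \<Rightarrow> (real \<Rightarrow> nat \<Rightarrow> 'v::real_normed_vector) \<Rightarrow> bool" where
  "flows_by n m b z \<longleftrightarrow>
    (\<forall>t. \<forall>j<n. ((\<lambda>t. z t j) has_vector_derivative (\<Sum>i<n. (m i * b j i) *\<^sub>R z t i)) (at t))"

lemma flow_exists:
  fixes x :: "nat \<Rightarrow> 'v::euclidean_space"
  obtains z where "\<And>j. z 0 j = x j" "flows_by n m b z"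
proof -
  have "\<exists>z. (\<forall>j. z 0 j = x j \<bullet> e) \<and> (\<forall>t j. j < n \<longrightarrow>
      ((\<lambda>t. z t j) has_real_derivative (\<Sum>i<n. (m i * b j i) * z t i)) (at t))" for e
    by (rule linear_system_solution_real[of "\<lambda>j. x j \<bullet> e" n "\<lambda>j i. m i * b j i"]) blast
  then obtain Z where Z: "\<And>e j. Z e 0 j = x j \<bullet> e" "\<And>e t j. j < n \<Longrightarrow>
      ((\<lambda>t. Z e t j) has_real_derivative (\<Sum>i<n. (m i * b j i) * Z e t i)) (at t)"
    by metis
  define z where "z t j = (\<Sum>e\<in>Basis. Z e t j *\<^sub>R e)" for t j
  have "flows_by n m b z" unfolding flows_by_def
  proof (intro allI impI)
    fix t j assume j: "j < n"
    have "((\<lambda>t. z t j) has_vector_derivative (\<Sum>e\<in>Basis. (\<Sum>i<n. (m i * b j i) * Z e t i) *\<^sub>R e)) (at t)"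
      unfolding z_def
      by (intro has_vector_derivative_sum) (use has_vector_derivative_scaleR[OF Z(2)[OF j] has_vector_derivative_const] in simp)
    also have "(\<Sum>e\<in>Basis. (\<Sum>i<n. (m i * b j i) * Z e t i) *\<^sub>R e) = (\<Sum>i<n. (m i * b j i) *\<^sub>R z t i)"
      unfolding z_def scaleR_sum_right scaleR_sum_left by (subst sum.swap) simp
    finally show "((\<lambda>t. z t j) has_vector_derivative (\<Sum>i<n. (m i * b j i) *\<^sub>R z t i)) (at t)" .
  qed
  moreover have "z 0 j = x j" for j by (simp add: z_def Z euclidean_representation)
  ultimately show ?thesis using that by blast
qed

lemma flows_by_linear_image:
  assumes "flows_by n m b z" "bounded_linear f"
  shows "flows_by n m b (\<lambda>t j. f (z t j))"
  unfolding flows_by_def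
proof (intro allI impI)
  fix t j assume "j < n"
  then have "((\<lambda>t. z t j) has_vector_derivative (\<Sum>i<n. (m i * b j i) *\<^sub>R z t i)) (at t)"
    using assms(1) by (simp add: flows_by_def)
  from bounded_linear.has_vector_derivative[OF assms(2) this]
  show "((\<lambda>t. f (z t j)) has_vector_derivative (\<Sum>i<n. (m i * b j i) *\<^sub>R f (z t i))) (at t)"
    using bounded_linear.linear[OF assms(2)] by (simp add: linear_sum linear_scale)
qed

lemma flows_by_reindex:
  assumes "flows_by n m b z" and \<pi>: "bij_betw \<pi> {..<n} {..<n}"
    and inv: "\<And>i. i < n \<Longrightarrow> m (\<pi> i) = m i" "\<And>i j. i < n \<Longrightarrow> j < n \<Longrightarrow> b (\<pi> j) (\<pi> i) = b j i"
  shows "flows_by n m b (\<lambda>t j. z t (\<pi> j))"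
  unfolding flows_by_def
proof (intro allI impI)
  fix t j assume j: "j < n"
  then have "\<pi> j < n" using \<pi> by (auto simp: bij_betw_def)
  then have "((\<lambda>t. z t (\<pi> j)) has_vector_derivative (\<Sum>i<n. (m i * b (\<pi> j) i) *\<^sub>R z t i)) (at t)"
    using assms(1) by (simp add: flows_by_def)
  also have "(\<Sum>i<n. (m i * b (\<pi> j) i) *\<^sub>R z t i) = (\<Sum>i<n. (m i * b j i) *\<^sub>R z t (\<pi> i))"
    using sum.reindex_bij_betw[OF \<pi>, of "\<lambda>i. (m i * b (\<pi> j) i) *\<^sub>R z t i"] inv j by simp
  finally show "((\<lambda>t. z t (\<pi> j)) has_vector_derivative (\<Sum>i<n. (m i * b j i) *\<^sub>R z t (\<pi> i))) (at t)" .
qed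

text \<open>The factor \<open>m\<^sub>i\<close> in the generator makes it skew for the weighted inner product when \<open>b\<close> is skew for the
  standard one.\<close>

lemma flow_conserves_inner_product:
  fixes y z :: "real \<Rightarrow> nat \<Rightarrow> real"
  assumes "flows_by n m b y" "flows_by n m b z"
    and skew: "\<And>i j. i < n \<Longrightarrow> j < n \<Longrightarrow> b j i = - b i j"
  shows "(\<Sum>j<n. m j * y t j * z t j) = (\<Sum>j<n. m j * y 0 j * z 0 j)"
proof -
  have "((\<lambda>t. \<Sum>j<n. m j * y t j * z t j) has_real_derivative 0) (at t)" for t
  proof -
    let ?y = "\<lambda>j. \<Sum>i<n. m i * b j i * y t i" and ?z = "\<lambda>j. \<Sum>i<n. m i * b j i * z t i"
    have "((\<lambda>t. y t j) has_real_derivative ?y j) (at t)" "((\<lambda>t. z t j) has_real_derivative ?z j) (at t)"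
      if "j < n" for j
      using assms(1,2) that by (auto simp: flows_by_def has_real_derivative_iff_has_vector_derivative)
    then have "((\<lambda>t. \<Sum>j<n. m j * y t j * z t j) has_real_derivative
        (\<Sum>j<n. m j * (?y j * z t j + y t j * ?z j))) (at t)"
      by (intro DERIV_sum) (auto intro!: derivative_eq_intros simp: algebra_simps)
    moreover have "(\<Sum>j<n. m j * (?y j * z t j + y t j * ?z j)) = 0"
    proof -
      have "(\<Sum>j<n. m j * (y t j * ?z j)) = (\<Sum>j<n. \<Sum>i<n. m i * m j * b j i * y t j * z t i)"
        by (simp add: sum_distrib_left algebra_simps)
      also have "\<dots> = (\<Sum>j<n. \<Sum>i<n. m j * m i * b i j * y t i * z t j)"
        by (rule sum.swap)
      also have "\<dots> = (\<Sum>j<n. \<Sum>i<n. - (m j * m i * b j i * y t i * z t j))"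
        by (intro sum.cong refl, subst skew) simp_all
      also have "\<dots> = - (\<Sum>j<n. m j * (?y j * z t j))"
        by (simp add: sum_distrib_left sum_distrib_right sum_negf algebra_simps)
      finally show ?thesis by (simp add: distrib_left sum.distrib)
    qed
    ultimately show ?thesis by simp
  qed
  then show ?thesis by (intro DERIV_isconst_all) blast
qed

text \<open>The difference of two solutions has a conserved weighted norm, which is zero initially. This is how
  symmetries of the initial value and of the generator pass to the whole solution.\<close>

lemma flow_unique:
  fixes y z :: "real \<Rightarrow> nat \<Rightarrow> 'v::real_inner"
  assumes "flows_by n m b y" "flows_by n m b z"
    and skew: "\<And>i j. i < n \<Longrightarrow> j < n \<Longrightarrow> b j i = - b i j"
    and m: "\<And>j. j < n \<Longrightarrow> m j > 0" and init: "\<And>j. j < n \<Longrightarrow> y 0 j = z 0 j" and j: "j < n"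
  shows "y t j = z t j"
proof -
  have "flows_by n m b (\<lambda>t j. y t j - z t j)"
    using assms(1,2) unfolding flows_by_def
    by (auto simp: scaleR_diff_right sum_subtractf intro!: has_vector_derivative_diff)
  then have d: "flows_by n m b (\<lambda>t j. (y t j - z t j) \<bullet> p)" for p
    by (rule flows_by_linear_image) (rule bounded_linear_inner_left)
  have "(y t j - z t j) \<bullet> p = 0" for p
  proof -
    have "(\<Sum>j<n. m j * ((y t j - z t j) \<bullet> p)^2) = 0"
      using flow_conserves_inner_product[OF d[of p] d[of p] skew, of t] init
      by (simp add: power2_eq_square mult.assoc)
    then have "m j * ((y t j - z t j) \<bullet> p)^2 = 0"
      using j m by (subst (asm) sum_nonneg_eq_0_iff) (auto simp: less_imp_le)
    then show ?thesis using m[OF j] by simp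
  qed
  from this[of "y t j - z t j"] show ?thesis by simp
qed

lemma flow_conserves_gram_matrix:
  assumes z: "flows_by n m b z" and skew: "\<And>i j. i < n \<Longrightarrow> j < n \<Longrightarrow> b j i = - b i j"
  shows "gram_matrix n m (z t) = gram_matrix n m (z 0)"
proof -
  have "flows_by n m b (\<lambda>t j. z t j $ a)" for a
    by (rule flows_by_linear_image[OF z]) (rule bounded_linear_vec_nth)
  from flow_conserves_inner_product[OF this this skew, of t]
  show ?thesis by (simp add: gram_matrix_def vec_eq_iff algebra_simps)
qed

lemma flow_conserves_weighted_sum:
  fixes z :: "real \<Rightarrow> nat \<Rightarrow> 'v::real_normed_vector"
  assumes z: "flows_by n m b z" and b: "\<And>i. i < n \<Longrightarrow> (\<Sum>j<n. m j * b j i) = 0"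
  shows "(\<Sum>j<n. m j *\<^sub>R z t j) = (\<Sum>j<n. m j *\<^sub>R z 0 j)"
proof -
  have "((\<lambda>t. \<Sum>j<n. m j *\<^sub>R z t j) has_vector_derivative 0) (at t within UNIV)" for t
  proof -
    have "((\<lambda>t. \<Sum>j<n. m j *\<^sub>R z t j) has_vector_derivative
        (\<Sum>j<n. m j *\<^sub>R (\<Sum>i<n. (m i * b j i) *\<^sub>R z t i))) (at t)"
      using z by (intro has_vector_derivative_sum
          bounded_linear.has_vector_derivative[OF bounded_linear_scaleR_right]) (auto simp: flows_by_def)
    also have "(\<Sum>j<n. m j *\<^sub>R (\<Sum>i<n. (m i * b j i) *\<^sub>R z t i)) =
        (\<Sum>i<n. (m i * (\<Sum>j<n. m j * b j i)) *\<^sub>R z t i)"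
      unfolding scaleR_sum_right sum_distrib_left scaleR_sum_left
      by (subst sum.swap) (simp add: algebra_simps)
    finally show ?thesis using b by simp
  qed
  then obtain c where "\<And>t. t \<in> UNIV \<Longrightarrow> (\<Sum>j<n. m j *\<^sub>R z t j) = c"
    by (rule has_vector_derivative_zero_constant[OF convex_UNIV]) blast
  then show ?thesis by simp
qed


section \<open>The potential and its gradient\<close>

text \<open>The sum runs over all ordered pairs; the diagonal terms are zero because division by zero gives
  zero.\<close>

definition pair_potential :: "nat \<Rightarrow> (nat \<Rightarrow> real) \<Rightarrow> (nat \<Rightarrow> 'v::real_inner) \<Rightarrow> real" where
  "pair_potential n m x = (\<Sum>i<n. \<Sum>j<n. m i * m j / norm (x i - x j)) / 2"

text \<open>This is the negative gradient of the potential at the point \<open>x\<^sub>j\<close>, divided by the mass \<open>m\<^sub>j\<close>. The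
  potential is a repulsive one: each term points away from another particle.\<close>

definition repulsion :: "nat \<Rightarrow> (nat \<Rightarrow> real) \<Rightarrow> (nat \<Rightarrow> 'v::real_inner) \<Rightarrow> nat \<Rightarrow> 'v" where
  "repulsion n m x j = (\<Sum>i<n. (m i / norm (x j - x i) ^ 3) *\<^sub>R (x j - x i))"

lemma inverse_norm_has_derivative:
  fixes f :: "real \<Rightarrow> 'v::real_inner"
  assumes f: "(f has_vector_derivative f') (at t)" and ne: "f t \<noteq> 0"
  shows "((\<lambda>t. c / norm (f t)) has_real_derivative - c * (f t \<bullet> f') / norm (f t) ^ 3) (at t)"
proof -
  have "((\<lambda>t. f t \<bullet> f t) has_real_derivative 2 * (f t \<bullet> f')) (at t)"
    using bounded_bilinear.has_vector_derivative[OF bounded_bilinear_inner f f]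
    by (simp add: has_real_derivative_iff_has_vector_derivative inner_commute)
  from DERIV_chain2[OF DERIV_real_sqrt this] have "((\<lambda>t. norm (f t)) has_real_derivative (f t \<bullet> f') / norm (f t)) (at t)"
    using ne by (simp add: norm_eq_sqrt_inner field_simps)
  from DERIV_cmult[OF DERIV_inverse_fun[OF this], of c] show ?thesis
    using ne by (simp add: divide_inverse power3_eq_cube mult_ac)
qed

lemma sum_antisymmetric_pairs:
  fixes F :: "nat \<Rightarrow> nat \<Rightarrow> real"
  assumes "\<And>i j. i < n \<Longrightarrow> j < n \<Longrightarrow> F j i = - F i j"
  shows "(\<Sum>j<n. \<Sum>i<n. F j i * (g j - g i)) = 2 * (\<Sum>j<n. \<Sum>i<n. F j i * g j)"
proof -
  have "(\<Sum>j<n. \<Sum>i<n. F j i * g i) = (\<Sum>j<n. \<Sum>i<n. F i j * g j)" by (rule sum.swap)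
  also have "\<dots> = (\<Sum>j<n. \<Sum>i<n. - (F j i * g j))" by (intro sum.cong refl, subst assms) simp_all
  finally show ?thesis by (simp add: right_diff_distrib sum_subtractf sum_negf)
qed

lemma repulsion_inner:
  "m j * (repulsion n m x j \<bullet> p) = (\<Sum>i<n. m j * m i * ((x j - x i) \<bullet> p) / norm (x j - x i) ^ 3)"
  by (simp add: repulsion_def inner_sum_left sum_distrib_left mult.assoc)

lemma pair_potential_has_derivative:
  fixes x :: "real \<Rightarrow> nat \<Rightarrow> 'v::real_inner"
  assumes x: "\<And>j. j < n \<Longrightarrow> ((\<lambda>t. x t j) has_vector_derivative v j) (at s)"
    and inj: "inj_on (x s) {..<n}"
  shows "((\<lambda>t. pair_potential n m (x t)) has_real_derivative
    - (\<Sum>j<n. m j * (repulsion n m (x s) j \<bullet> v j))) (at s)"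
proof -
  let ?d = "\<lambda>j i. x s j - x s i"
  have "((\<lambda>t. m j * m i / norm (x t j - x t i)) has_real_derivative
      - (m j * m i) * (?d j i \<bullet> (v j - v i)) / norm (?d j i) ^ 3) (at s)" if "j < n" "i < n" for i j
  proof (cases "i = j")
    case False
    then have "?d j i \<noteq> 0" using inj that by (auto simp: inj_on_def)
    then show ?thesis
      using inverse_norm_has_derivative[OF has_vector_derivative_diff[OF x x]] that by blast
  qed simp
  then have "((\<lambda>t. pair_potential n m (x t)) has_real_derivative
      (\<Sum>j<n. \<Sum>i<n. - (m j * m i) * (?d j i \<bullet> (v j - v i)) / norm (?d j i) ^ 3) / 2) (at s)"
    unfolding pair_potential_def by (intro DERIV_cdivide DERIV_sum) auto
  moreover have "(\<Sum>j<n. \<Sum>i<n. - (m j * m i) * (?d j i \<bullet> (v j - v i)) / norm (?d j i) ^ 3) =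
      - 2 * (\<Sum>j<n. m j * (repulsion n m (x s) j \<bullet> v j))"
  proof -
    let ?F = "\<lambda>j i. m j * m i / norm (?d j i) ^ 3"
    have a: "(\<Sum>j<n. \<Sum>i<n. ?F j i * (?d j i \<bullet> v i)) = (\<Sum>j<n. \<Sum>i<n. ?F i j * (?d i j \<bullet> v j))"
      by (rule sum.swap)
    have b: "?F i j * (?d i j \<bullet> v j) = - (?F j i * (?d j i \<bullet> v j))" for i j
      by (simp add: norm_minus_commute inner_diff_left algebra_simps diff_divide_distrib)
    have "(\<Sum>j<n. \<Sum>i<n. ?F j i * (?d j i \<bullet> v i)) = - (\<Sum>j<n. \<Sum>i<n. ?F j i * (?d j i \<bullet> v j))"
      unfolding a sum_negf[symmetric] by (intro sum.cong refl) (rule b)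
    moreover have "(\<Sum>j<n. \<Sum>i<n. ?F j i * (?d j i \<bullet> v j)) = (\<Sum>j<n. m j * (repulsion n m (x s) j \<bullet> v j))"
      by (simp add: repulsion_inner)
    moreover have "(\<Sum>j<n. \<Sum>i<n. - (m j * m i) * (?d j i \<bullet> (v j - v i)) / norm (?d j i) ^ 3) =
       (\<Sum>j<n. \<Sum>i<n. ?F j i * (?d j i \<bullet> v i) - ?F j i * (?d j i \<bullet> v j))"
      by (intro sum.cong refl) (simp add: inner_diff_right right_diff_distrib diff_divide_distrib)
    ultimately show ?thesis by (simp add: sum_subtractf)
  qed
  ultimately show ?thesis by simp
qed

lemma total_repulsion_zero: "(\<Sum>j<n. m j *\<^sub>R repulsion n m x j) = 0"
proof -
  have "(\<Sum>j<n. m j *\<^sub>R repulsion n m x j) = (\<Sum>j<n. \<Sum>i<n. (m j * m i / norm (x j - x i) ^ 3) *\<^sub>R (x j - x i))"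
    (is "?s = _") by (simp add: repulsion_def scaleR_sum_right)
  also have "\<dots> = (\<Sum>j<n. \<Sum>i<n. (m i * m j / norm (x i - x j) ^ 3) *\<^sub>R (x i - x j))" by (rule sum.swap)
  also have "\<dots> = - (\<Sum>j<n. \<Sum>i<n. (m j * m i / norm (x j - x i) ^ 3) *\<^sub>R (x j - x i))"
    unfolding sum_negf[symmetric]
    by (intro sum.cong refl) (simp add: norm_minus_commute mult.commute flip: scaleR_minus_right)
  also have "\<dots> = - ?s" by (simp add: repulsion_def scaleR_sum_right)
  finally show ?thesis by (simp add: eq_neg_iff_add_eq_0 flip: scaleR_2)
qed

text \<open>The total torque vanishes since the forces between two points are along their difference. This is the
  infinitesimal form of the rotation invariance of the potential.\<close>

lemma repulsion_torque_symmetric: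
  "(\<Sum>j<n. m j * (repulsion n m x j \<bullet> p) * (x j \<bullet> q)) = (\<Sum>j<n. m j * (repulsion n m x j \<bullet> q) * (x j \<bullet> p))"
proof -
  have "2 * (\<Sum>j<n. m j * (repulsion n m x j \<bullet> p) * (x j \<bullet> q)) =
     (\<Sum>j<n. \<Sum>i<n. m j * m i * ((x j - x i) \<bullet> p) * ((x j - x i) \<bullet> q) / norm (x j - x i) ^ 3)" for p q
  proof -
    let ?F = "\<lambda>j i. m j * m i * ((x j - x i) \<bullet> p) / norm (x j - x i) ^ 3"
    have "?F j i = - ?F i j" for i j
      by (simp add: norm_minus_commute inner_diff_left algebra_simps diff_divide_distrib)
    then have "(\<Sum>j<n. \<Sum>i<n. ?F j i * (x j \<bullet> q - x i \<bullet> q)) = 2 * (\<Sum>j<n. \<Sum>i<n. ?F j i * (x j \<bullet> q))"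
      by (intro sum_antisymmetric_pairs)
    then show ?thesis by (simp add: repulsion_inner sum_distrib_right inner_diff_left)
  qed
  from this[of p q] this[of q p] show ?thesis by (simp add: mult_ac)
qed

lemma repulsion_equivariant:
  assumes f: "linear f" "\<And>u. norm (f u) = norm u" and \<pi>: "bij_betw \<pi> {..<n} {..<n}"
    and x: "\<And>i. i < n \<Longrightarrow> f (x i) = x (\<pi> i)" and m: "\<And>i. i < n \<Longrightarrow> m (\<pi> i) = m i" and j: "j < n"
  shows "repulsion n m x (\<pi> j) = f (repulsion n m x j)"
proof -
  have "repulsion n m x (\<pi> j) =
      (\<Sum>i<n. (m (\<pi> i) / norm (x (\<pi> j) - x (\<pi> i)) ^ 3) *\<^sub>R (x (\<pi> j) - x (\<pi> i)))"
    unfolding repulsion_def by (rule sum.reindex_bij_betw[OF \<pi>, symmetric])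
  also have "\<dots> = (\<Sum>i<n. (m i / norm (f (x j - x i)) ^ 3) *\<^sub>R f (x j - x i))"
    by (intro sum.cong refl) (use x m j in \<open>simp add: linear_diff[OF f(1)]\<close>)
  also have "\<dots> = f (repulsion n m x j)"
    by (simp add: repulsion_def f(2) linear_sum[OF f(1)] linear_scale[OF f(1)])
  finally show ?thesis .
qed

section \<open>Ordered configurations\<close>

lemma fst_forget_order [simp]: "fst (forget_order n (x, m)) = x ` {..<n}"
  by (simp add: forget_order_def)

lemma snd_forget_order:
  assumes "inj_on x {..<n}" "i < n"
  shows "snd (forget_order n (x, m)) (x i) = m i"
  using assms by (simp add: forget_order_def the_inv_into_f_f)

lemma ordered_configurationsD:
  assumes "(x, m) \<in> ordered_configurations n"
  shows "inj_on x {..<n}" "\<And>i. i < n \<Longrightarrow> m i > 0" "(\<Sum>i<n. m i *\<^sub>R x i) = 0"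
    "x \<in> extensional {..<n}" "m \<in> {..<n} \<rightarrow>\<^sub>E {0<..}"
  using assms by (auto simp: ordered_configurations_def PiE_iff)

lemma inertia_matrix_ordered:
  assumes "(x, m) \<in> ordered_configurations n"
  shows "inertia_matrix (forget_order n (x, m)) = gram_matrix n m x"
  unfolding gram_matrix_def by (rule inertia_matrix_forget_order[OF assms])

lemma potential_forget_order:
  assumes "(x, m) \<in> ordered_configurations n"
  shows "potential (forget_order n (x, m)) = pair_potential n m x"
proof -
  note inj = ordered_configurationsD(1)[OF assms]
  let ?C = "x ` {..<n}" and ?\<mu> = "snd (forget_order n (x, m))"
  let ?h = "\<lambda>p q. ?\<mu> p * ?\<mu> q / norm (p - q)"
  have "potential (forget_order n (x, m)) =
      (\<Sum>(p, q)\<in>{(p, q). p \<in> ?C \<and> q \<in> ?C \<and> p \<noteq> q}. ?h p q) / 2"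
    by (simp add: potential_def forget_order_def)
  also have "(\<Sum>(p, q)\<in>{(p, q). p \<in> ?C \<and> q \<in> ?C \<and> p \<noteq> q}. ?h p q) = (\<Sum>(p, q)\<in>?C \<times> ?C. ?h p q)"
    by (rule sum.mono_neutral_left) auto
  also have "\<dots> = (\<Sum>p\<in>?C. \<Sum>q\<in>?C. ?h p q)"
    by (rule sum.cartesian_product[symmetric])
  also have "\<dots> = (\<Sum>i<n. \<Sum>j<n. m i * m j / norm (x i - x j))"
    using inj by (simp add: sum.reindex snd_forget_order)
  finally show ?thesis by (simp add: pair_potential_def)
qed

text \<open>A curve through a configuration may start at any of its orderings; this moves between them.\<close>

lemma forget_order_eq_imp_permuted:
  assumes xm: "(x, m) \<in> ordered_configurations n" and ym: "(y, m') \<in> ordered_configurations n"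
    and eq: "forget_order n (x, m) = forget_order n (y, m')"
  obtains \<tau> where "bij_betw \<tau> {..<n} {..<n}"
    "\<And>i. i < n \<Longrightarrow> y i = x (\<tau> i)" "\<And>i. i < n \<Longrightarrow> m' i = m (\<tau> i)"
proof -
  note injx = ordered_configurationsD(1)[OF xm] and injy = ordered_configurationsD(1)[OF ym]
  have C: "x ` {..<n} = y ` {..<n}" using arg_cong[OF eq, of fst] by simp
  define \<tau> where "\<tau> = the_inv_into {..<n} x \<circ> y"
  have bij: "bij_betw \<tau> {..<n} {..<n}"
    unfolding \<tau>_def
    using bij_betw_trans[OF inj_on_imp_bij_betw[OF injy]
        bij_betw_the_inv_into[OF inj_on_imp_bij_betw[OF injx], unfolded C]] .
  moreover have y: "y i = x (\<tau> i)" if "i < n" for i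
  proof -
    have "y i \<in> x ` {..<n}" using C that by auto
    then show ?thesis by (simp add: \<tau>_def f_the_inv_into_f[OF injx])
  qed
  moreover have "m' i = m (\<tau> i)" if i: "i < n" for i
  proof -
    have "\<tau> i < n" using bij i by (auto simp: bij_betw_def)
    then show ?thesis
      using snd_forget_order[OF injx, of "\<tau> i" m] snd_forget_order[OF injy i, of m'] eq y[OF i] by simp
  qed
  ultimately show ?thesis using that by blast
qed

lemma permuted_ordered_configuration:
  assumes xm: "(x, m) \<in> ordered_configurations n" and \<tau>: "bij_betw \<tau> {..<n} {..<n}"
  shows "(restrict (x \<circ> \<tau>) {..<n}, restrict (m \<circ> \<tau>) {..<n}) \<in> ordered_configurations n"
    "forget_order n (restrict (x \<circ> \<tau>) {..<n}, restrict (m \<circ> \<tau>) {..<n}) = forget_order n (x, m)"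
proof -
  note D = ordered_configurationsD[OF xm]
  have im: "\<tau> ` {..<n} = {..<n}" and inj: "inj_on \<tau> {..<n}" and lt: "\<And>i. i < n \<Longrightarrow> \<tau> i < n"
    using \<tau> by (auto simp: bij_betw_def)
  let ?y = "restrict (x \<circ> \<tau>) {..<n}" and ?m = "restrict (m \<circ> \<tau>) {..<n}"
  have injy: "inj_on ?y {..<n}"
    using comp_inj_on[OF inj, of x] D(1) im by (simp add: inj_on_restrict_eq)
  moreover have "(\<Sum>i<n. ?m i *\<^sub>R ?y i) = 0"
    using sum.reindex_bij_betw[OF \<tau>, of "\<lambda>i. m i *\<^sub>R x i"] D(3) by simp
  ultimately show "(?y, ?m) \<in> ordered_configurations n"
    using D(2) lt by (auto simp: ordered_configurations_def)
  have C: "?y ` {..<n} = x ` {..<n}"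
    using im by (metis image_comp image_restrict_eq)
  have "the_inv_into {..<n} ?y (x (\<tau> i)) = i" if "i < n" for i
    using the_inv_into_f_f[OF injy, of i] that by simp
  then have "?m (the_inv_into {..<n} ?y p) = m (the_inv_into {..<n} x p)" if p: "p \<in> x ` {..<n}" for p
  proof -
    obtain i where i: "i < n" "p = x (\<tau> i)" using p im by (metis imageE lessThan_iff)
    then show ?thesis
      using the_inv_into_f_f[OF injy, of i] the_inv_into_f_f[OF D(1), of "\<tau> i"] lt by simp
  qed
  then show "forget_order n (?y, ?m) = forget_order n (x, m)"
    unfolding forget_order_def prod.case C by (auto simp: restrict_def fun_eq_iff)
qed

lemma orthogonal_subgroup_matrix_inv:
  assumes "orthogonal_subgroup G" "g \<in> G"
  shows "matrix_inv g \<in> G" "matrix_inv g *v (g *v x) = x" "g *v (matrix_inv g *v x) = x" "norm (g *v x) = norm x"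
proof -
  have g: "orthogonal_matrix g" using assms by (auto simp: orthogonal_subgroup_def)
  then have inv: "invertible g" using invertible_def orthogonal_matrix_def by blast
  show "matrix_inv g \<in> G" using assms by (auto simp: orthogonal_subgroup_def)
  have "g ** matrix_inv g = mat 1 \<and> matrix_inv g ** g = mat 1"
    using inv unfolding invertible_def matrix_inv_def by (rule someI_ex)
  then show "matrix_inv g *v (g *v x) = x" "g *v (matrix_inv g *v x) = x"
    by (simp_all add: matrix_vector_mul_assoc)
  show "norm (g *v x) = norm x"
    using g by (simp add: orthogonal_transformation_matrix orthogonal_transformation_norm)
qed

text \<open>In an ordering, symmetry becomes a finite disjunction of closed conditions, and it can be compared
  between nearby configurations through the permutations \<open>\<pi>\<close>.\<close>

lemma symmetric_config_forget_order:
  assumes G: "orthogonal_subgroup G" and xm: "(x, m) \<in> ordered_configurations n"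
  shows "symmetric_config G (forget_order n (x, m)) \<longleftrightarrow>
    (\<forall>g\<in>G. \<exists>\<pi>. bij_betw \<pi> {..<n} {..<n} \<and> (\<forall>i<n. g *v x i = x (\<pi> i) \<and> m (\<pi> i) = m i))"
proof -
  note inj = ordered_configurationsD(1)[OF xm]
  let ?C = "x ` {..<n}"
  obtain \<mu> where fo: "forget_order n (x, m) = (?C, \<mu>)" and ext: "\<mu> \<in> extensional ?C"
    by (simp add: forget_order_def)
  have \<mu>: "\<mu> (x i) = m i" if "i < n" for i using snd_forget_order[OF inj that, of m] fo by simp
  have act: "config_act g (forget_order n (x, m)) = forget_order n (x, m) \<longleftrightarrow>
     (\<exists>\<pi>. bij_betw \<pi> {..<n} {..<n} \<and> (\<forall>i<n. g *v x i = x (\<pi> i) \<and> m (\<pi> i) = m i))" if g: "g \<in> G" for g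
  proof
    note ginv = orthogonal_subgroup_matrix_inv[OF G g]
    assume "config_act g (forget_order n (x, m)) = forget_order n (x, m)"
    then have gC: "(*v) g ` ?C = ?C" and g\<mu>: "restrict (\<lambda>x. \<mu> (matrix_inv g *v x)) ((*v) g ` ?C) = \<mu>"
      unfolding fo config_act_def by auto
    have "\<forall>i\<in>{..<n}. \<exists>j\<in>{..<n}. g *v x i = x j" using gC by blast
    then obtain \<pi> where \<pi>: "\<And>i. i < n \<Longrightarrow> \<pi> i < n" "\<And>i. i < n \<Longrightarrow> g *v x i = x (\<pi> i)"
      by (metis lessThan_iff)
    have "inj_on \<pi> {..<n}"
      using \<pi>(2) inj ginv(2) by (metis (no_types, lifting) inj_onD inj_onI lessThan_iff)
    then have "bij_betw \<pi> {..<n} {..<n}"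
      using \<pi>(1) by (intro bij_betw_imageI endo_inj_surj) auto
    moreover have "m (\<pi> i) = m i" if i: "i < n" for i
    proof -
      have "m (\<pi> i) = \<mu> (g *v x i)" using \<mu>[of "\<pi> i"] \<pi> i by simp
      also have "\<dots> = \<mu> (matrix_inv g *v (g *v x i))" by (subst g\<mu>[symmetric]) (use i in simp)
      also have "\<dots> = m i" using \<mu>[OF i] by (simp add: ginv(2))
      finally show ?thesis .
    qed
    ultimately show "\<exists>\<pi>. bij_betw \<pi> {..<n} {..<n} \<and> (\<forall>i<n. g *v x i = x (\<pi> i) \<and> m (\<pi> i) = m i)"
      using \<pi> by blast
  next
    note ginv = orthogonal_subgroup_matrix_inv[OF G g]
    assume "\<exists>\<pi>. bij_betw \<pi> {..<n} {..<n} \<and> (\<forall>i<n. g *v x i = x (\<pi> i) \<and> m (\<pi> i) = m i)"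
    then obtain \<pi> where \<pi>: "bij_betw \<pi> {..<n} {..<n}"
      "\<And>i. i < n \<Longrightarrow> g *v x i = x (\<pi> i)" "\<And>i. i < n \<Longrightarrow> m (\<pi> i) = m i" by blast
    have lt: "\<pi> i < n" if "i < n" for i using \<pi>(1) that by (auto simp: bij_betw_def)
    have "(*v) g ` ?C = x ` \<pi> ` {..<n}" using \<pi>(2) by (force simp: image_iff)
    then have gC: "(*v) g ` ?C = ?C" using \<pi>(1) by (simp add: bij_betw_def)
    have "restrict (\<lambda>x. \<mu> (matrix_inv g *v x)) ((*v) g ` ?C) p = \<mu> p" for p
    proof (cases "p \<in> ?C")
      case True
      then have "p \<in> (*v) g ` ?C" unfolding gC .
      then obtain i where i: "i < n" "p = g *v x i" by auto
      then have "\<mu> p = m i" using \<mu>[OF lt[OF i(1)]] \<pi> by simp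
      moreover have "\<mu> (matrix_inv g *v p) = m i" using i \<mu>[OF i(1)] ginv(2) by simp
      ultimately show ?thesis unfolding gC using True by simp
    next
      case False
      then show ?thesis unfolding gC using ext by (simp add: extensional_def)
    qed
    then show "config_act g (forget_order n (x, m)) = forget_order n (x, m)"
      unfolding fo config_act_def prod.case by (simp only: gC prod.inject) blast
  qed
  then show ?thesis by (auto simp: symmetric_config_def)
qed


section \<open>The topology of the configuration space\<close>

lemma continuous_map_position:
  "i < n \<Longrightarrow> continuous_map (ordered_topology n) euclidean (\<lambda>p. fst p i)"
  unfolding ordered_topology_def
  by (intro continuous_map_from_subtopology continuous_map_compose[OF continuous_map_fst, unfolded comp_def]
      continuous_map_product_projection) auto

lemma continuous_map_mass:
  assumes "i < n"
  shows "continuous_map (ordered_topology n) euclideanreal (\<lambda>p. snd p i)"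
proof -
  have disc: "continuous_map (ordered_topology n) (discrete_topology {0<..}) (\<lambda>p. snd p i)"
    unfolding ordered_topology_def
    by (intro continuous_map_from_subtopology continuous_map_compose[OF continuous_map_snd, unfolded comp_def]
      continuous_map_product_projection) (use assms in auto)
  have "continuous_map (discrete_topology {0<..}) euclideanreal (\<lambda>x. x)" by simp
  from continuous_map_compose[OF disc this] show ?thesis by (simp add: comp_def)
qed

lemma continuous_map_position_compose:
  assumes "i < n" "continuous_on UNIV h"
  shows "continuous_map (ordered_topology n) euclidean (\<lambda>p. h (fst p i))"
  using continuous_map_compose[OF continuous_map_position[OF assms(1)], of euclidean h] assms(2)
  by (simp add: comp_def)

lemma closedin_equalizer_euclidean:
  fixes f g :: "'a \<Rightarrow> 'b::real_normed_vector"
  assumes "continuous_map X euclidean f" "continuous_map X euclidean g"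
  shows "closedin X {x \<in> topspace X. f x = g x}"
  using closedin_continuous_map_preimage[OF continuous_map_diff[OF assms], of "{0}"] by simp

lemma quotient_map_forget_order:
  "quotient_map (ordered_topology n) (config_topology n) (forget_order n)"
  unfolding config_topology_def by (rule quotient_map_quotient_topology)

lemma closedin_config_topologyI:
  fixes S :: "'d::finite config set"
  assumes "S \<subseteq> configurations n"
    and "closedin (ordered_topology n) {p \<in> ordered_configurations n. forget_order n p \<in> S}"
  shows "closedin (config_topology n) S"
proof -
  have "quotient_map (ordered_topology n :: 'd ordered_config topology) (config_topology n) (forget_order n)"
    by (rule quotient_map_forget_order)
  then show ?thesis
    using assms unfolding quotient_map_closedin topspace_config_topology topspace_ordered_topology by blast
qed

lemma closedin_symmetric_configs:
  fixes G :: "(real^'d^'d) set"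
  assumes G: "orthogonal_subgroup G" "finite G"
  shows "closedin (config_topology n) {c \<in> configurations n. symmetric_config G c}"
proof (rule closedin_config_topologyI)
  let ?O = "ordered_configurations n :: 'd ordered_config set"
  \<comment> \<open>For each of the finitely many permutations, being permuted by \<open>g\<close> in that way is a closed condition.\<close>
  let ?E = "\<lambda>g \<pi>. {p \<in> ?O. \<forall>i<n. g *v fst p i = fst p (\<pi> i) \<and> snd p (\<pi> i) = snd p i}"
  let ?B = "{\<pi> \<in> {..<n} \<rightarrow>\<^sub>E {..<n}. bij_betw \<pi> {..<n} {..<n}}"
  have closed_E: "closedin (ordered_topology n) (?E g \<pi>)" if \<pi>: "\<pi> \<in> ?B" for g \<pi>
  proof -
    have "closedin (ordered_topology n) ({p \<in> topspace (ordered_topology n). g *v fst p i = fst p (\<pi> i)} \<inter>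
        {p \<in> topspace (ordered_topology n). snd p (\<pi> i) = snd p i})" if "i < n" for i
      using that \<pi>
      by (intro closedin_Int closedin_equalizer_euclidean continuous_map_position continuous_map_mass
          continuous_map_position_compose[of _ _ "(*v) g"] linear_continuous_on matrix_vector_mul_bounded_linear) auto
    then have "closedin (ordered_topology n) (?O \<inter> (\<Inter>i\<in>{..<n}. {p \<in> topspace (ordered_topology n). g *v fst p i = fst p (\<pi> i)} \<inter>
        {p \<in> topspace (ordered_topology n). snd p (\<pi> i) = snd p i}))"
      using closedin_Inter[of "insert ?O ((\<lambda>i. {p \<in> topspace (ordered_topology n). g *v fst p i = fst p (\<pi> i)} \<inter>
        {p \<in> topspace (ordered_topology n). snd p (\<pi> i) = snd p i}) ` {..<n})"]
        closedin_topspace[of "ordered_topology n :: 'd ordered_config topology"]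
      by (auto simp: topspace_ordered_topology)
    moreover have "(?O \<inter> (\<Inter>i\<in>{..<n}. {p \<in> topspace (ordered_topology n). g *v fst p i = fst p (\<pi> i)} \<inter>
        {p \<in> topspace (ordered_topology n). snd p (\<pi> i) = snd p i})) = ?E g \<pi>"
      by (auto simp: topspace_ordered_topology)
    ultimately show ?thesis by simp
  qed
  have "finite ?B" by (rule finite_subset[OF _ finite_PiE[of "{..<n}" "\<lambda>_. {..<n}"]]) auto
  then have "closedin (ordered_topology n) (\<Union>\<pi>\<in>?B. ?E g \<pi>)" for g
    by (intro closedin_Union) (use closed_E in auto)
  then have "closedin (ordered_topology n) (\<Inter>g\<in>G. \<Union>\<pi>\<in>?B. ?E g \<pi>)"
    using G by (intro closedin_Inter) (auto simp: orthogonal_subgroup_def)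
  moreover have "{p \<in> ?O. forget_order n p \<in> {c \<in> configurations n. symmetric_config G c}} =
      (\<Inter>g\<in>G. \<Union>\<pi>\<in>?B. ?E g \<pi>)"
  proof (intro set_eqI)
    fix p :: "'d ordered_config"
    obtain x m where p: "p = (x, m)" by fastforce
    have "(\<exists>\<pi>. bij_betw \<pi> {..<n} {..<n} \<and> (\<forall>i<n. g *v x i = x (\<pi> i) \<and> m (\<pi> i) = m i)) \<longleftrightarrow>
       (\<exists>\<pi>\<in>?B. \<forall>i<n. g *v x i = x (\<pi> i) \<and> m (\<pi> i) = m i)" for g
    proof
      assume "\<exists>\<pi>. bij_betw \<pi> {..<n} {..<n} \<and> (\<forall>i<n. g *v x i = x (\<pi> i) \<and> m (\<pi> i) = m i)"
      then obtain \<pi> where \<pi>: "bij_betw \<pi> {..<n} {..<n}" "\<forall>i<n. g *v x i = x (\<pi> i) \<and> m (\<pi> i) = m i" by blast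
      have "bij_betw (restrict \<pi> {..<n}) {..<n} {..<n}"
        using \<pi>(1) bij_betw_cong[of "{..<n}" "restrict \<pi> {..<n}" \<pi>] by simp
      moreover have "restrict \<pi> {..<n} \<in> {..<n} \<rightarrow>\<^sub>E {..<n}" using \<pi>(1) by (auto simp: bij_betw_def)
      ultimately show "\<exists>\<pi>\<in>?B. \<forall>i<n. g *v x i = x (\<pi> i) \<and> m (\<pi> i) = m i"
        using \<pi>(2) by (intro bexI[of _ "restrict \<pi> {..<n}"]) auto
    qed blast
    moreover have "G \<noteq> {}" using G by (auto simp: orthogonal_subgroup_def)
    ultimately show "p \<in> {p \<in> ?O. forget_order n p \<in> {c \<in> configurations n. symmetric_config G c}} \<longleftrightarrow>
        p \<in> (\<Inter>g\<in>G. \<Union>\<pi>\<in>?B. ?E g \<pi>)"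
      using symmetric_config_forget_order[OF G(1), of x m n] forget_order_in_configurations[of p n]
      by (auto simp: p)
  qed
  ultimately show "closedin (ordered_topology n)
      {p \<in> ?O. forget_order n p \<in> {c \<in> configurations n. symmetric_config G c}}" by simp
qed auto

text \<open>Among symmetric matrices the spectrum and the characteristic polynomial determine each other, and the values
  of the latter are continuous functions of the configuration. They are compared with those of one reference
  configuration.\<close>

lemma closedin_configs_with_spectrum:
  "closedin (config_topology n) (configs_with_spectrum n \<sigma> :: 'd::finite config set)"
proof (cases "configs_with_spectrum n \<sigma> = ({} :: 'd config set)")
  case False
  let ?O = "ordered_configurations n :: 'd ordered_config set"
  let ?S = "\<lambda>p :: 'd ordered_config. gram_matrix n (snd p) (fst p)"
  obtain c0 :: "'d config" where c0: "c0 \<in> configurations n" "inertia_spectrum c0 = \<sigma>"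
    using False by (auto simp: configs_with_spectrum_def)
  then obtain p0 where p0: "p0 \<in> ?O" "forget_order n p0 = c0" using forget_order_surj by blast
  have im: "inertia_matrix (forget_order n p) = ?S p" if "p \<in> ?O" for p
    using that inertia_matrix_ordered[of "fst p" "snd p"] by simp
  have iff: "forget_order n p \<in> configs_with_spectrum n \<sigma> \<longleftrightarrow> (\<forall>z. det (mat z - ?S p) = det (mat z - ?S p0))"
    if p: "p \<in> ?O" for p
  proof -
    have "forget_order n p \<in> configs_with_spectrum n \<sigma> \<longleftrightarrow> spectrum (?S p) = spectrum (?S p0)"
      using forget_order_in_configurations[OF p] c0 p0 im[OF p] im[OF p0(1)]
      by (auto simp: configs_with_spectrum_def inertia_spectrum_def)
    also have "\<dots> \<longleftrightarrow> charpoly (?S p) = charpoly (?S p0)"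
      by (rule symmetric_spectrum_eq_iff) simp_all
    also have "\<dots> \<longleftrightarrow> (\<forall>z. det (mat z - ?S p) = det (mat z - ?S p0))"
      by (simp add: fun_eq_iff flip: poly_eq_poly_eq_iff poly_charpoly)
    finally show ?thesis .
  qed
  have "continuous_map (ordered_topology n) euclideanreal (\<lambda>p. det (mat z - ?S p))" for z
  proof -
    have "continuous_map (ordered_topology n) euclideanreal (\<lambda>p. (mat z - ?S p) $ a $ b)" for a b
      unfolding gram_matrix_def vector_minus_component vec_lambda_beta
      by (intro continuous_map_diff continuous_map_sum continuous_map_real_mult continuous_map_mass
          continuous_map_position_compose[where h = "\<lambda>x. x $ _"] continuous_intros) auto
    then show ?thesis
      unfolding det_def by (intro continuous_map_sum continuous_map_real_mult continuous_map_prod) auto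
  qed
  then have "closedin (ordered_topology n) {p \<in> topspace (ordered_topology n). det (mat z - ?S p) = det (mat z - ?S p0)}" for z
    by (intro closedin_equalizer_euclidean) auto
  then have "closedin (ordered_topology n) (\<Inter>z. {p \<in> topspace (ordered_topology n). det (mat z - ?S p) = det (mat z - ?S p0)})"
    by (intro closedin_Inter) auto
  moreover have "(\<Inter>z. {p \<in> topspace (ordered_topology n). det (mat z - ?S p) = det (mat z - ?S p0)}) =
      {p \<in> ?O. forget_order n p \<in> configs_with_spectrum n \<sigma>}"
    using iff by (auto simp: topspace_ordered_topology)
  ultimately show ?thesis
    by (intro closedin_config_topologyI) (auto simp: configs_with_spectrum_def)
qed simp

lemma closedin_symmetric_configs_with_spectrum:
  fixes G :: "(real^'d^'d) set"
  assumes "orthogonal_subgroup G" "finite G"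
  shows "closedin (config_topology n) (symmetric_configs_with_spectrum G n \<sigma>)"
proof -
  have "symmetric_configs_with_spectrum G n \<sigma> =
      configs_with_spectrum n \<sigma> \<inter> {c \<in> configurations n. symmetric_config G c}"
    by (auto simp: symmetric_configs_with_spectrum_def configs_with_spectrum_def)
  then show ?thesis
    using closedin_Int[OF closedin_configs_with_spectrum closedin_symmetric_configs[OF assms]] by simp
qed

lemma continuous_map_forget_order:
  assumes y: "\<And>i. i < n \<Longrightarrow> continuous_map T euclidean (\<lambda>s. y s i)"
    and O: "\<And>s. s \<in> topspace T \<Longrightarrow> (y s, m) \<in> ordered_configurations n"
  shows "continuous_map T (config_topology n) (\<lambda>s. forget_order n (y s, m))"
proof -
  have "continuous_map T (ordered_topology n) (\<lambda>s. (y s, m))"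
    unfolding ordered_topology_def continuous_map_in_subtopology
  proof
    have "continuous_map T (product_topology (\<lambda>_. euclidean) {..<n}) y"
      using y O ordered_configurationsD(4) by (fastforce simp: continuous_map_componentwise)
    moreover have "m \<in> topspace (product_topology (\<lambda>_. discrete_topology {0<..}) {..<n})" if "topspace T \<noteq> {}"
      using that O ordered_configurationsD(5) by fastforce
    ultimately show "continuous_map T (prod_topology (product_topology (\<lambda>_. euclidean) {..<n})
         (product_topology (\<lambda>_. discrete_topology {0<..}) {..<n})) (\<lambda>s. (y s, m))"
      by (intro continuous_map_pairedI) auto
  qed (use O in auto)
  from continuous_map_compose[OF this quotient_imp_continuous_map[OF quotient_map_forget_order]]
  show ?thesis by (simp add: comp_def)
qed

section \<open>Minimisers of the potential\<close>

text \<open>On the set where \<open>U\<close> is at most its value at \<open>x0\<close>, every pair satisfies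
  \<open>m\<^sub>i m\<^sub>j / |y\<^sub>i - y\<^sub>j| \<le> 2 U(x0)\<close>, and the largest eigenvalue \<open>b\<close> of \<open>S\<close> gives \<open>m\<^sub>i |y\<^sub>i|\<^sup>2 \<le> b\<close>. These closed conditions
  define a compact set \<open>P\<close> of positions without collisions, on which \<open>U\<close> is continuous.\<close>

lemma potential_attains_minimum:
  fixes K :: "'d::finite config set"
  assumes K: "closedin (config_topology n) K" "K \<subseteq> configs_with_spectrum n \<sigma>"
    and x0: "(x0, m) \<in> ordered_configurations n" "forget_order n (x0, m) \<in> K"
  obtains x where "(x, m) \<in> ordered_configurations n" "forget_order n (x, m) \<in> K"
    "\<And>y. (y, m) \<in> ordered_configurations n \<Longrightarrow> forget_order n (y, m) \<in> K \<Longrightarrow>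
      pair_potential n m x \<le> pair_potential n m y"
proof -
  let ?V = "pair_potential n m"
  let ?X = "product_topology (\<lambda>_. euclidean :: (real^'d) topology) {..<n}"
  have m: "m i > 0" if "i < n" for i using ordered_configurationsD(2)[OF x0(1) that] .
  obtain b where b: "b \<ge> 0" "\<And>c. c \<in># \<sigma> \<Longrightarrow> c \<le> b"
    by (rule that[of "Max (insert 0 (set_mset \<sigma>))"]) auto
  have bounded: "norm (y i) \<le> sqrt (b / m i)"
    if y: "(y, m) \<in> ordered_configurations n" "forget_order n (y, m) \<in> K" and i: "i < n" for y i
  proof (cases "y i = 0")
    case False
    have "spectrum (gram_matrix n m y) = \<sigma>"
      using y K(2) inertia_matrix_ordered[OF y(1)] by (auto simp: configs_with_spectrum_def inertia_spectrum_def)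
    then have "y i \<bullet> (gram_matrix n m y *v y i) \<le> b * (y i \<bullet> y i)"
      using b by (intro symmetric_quadratic_form_le) auto
    moreover have "m i * (y i \<bullet> y i)^2 \<le> y i \<bullet> (gram_matrix n m y *v y i)"
    proof -
      have "m i * (y i \<bullet> y i)^2 \<le> (\<Sum>j<n. m j * (y j \<bullet> y i)^2)"
        using i m by (intro member_le_sum[of i "{..<n}" "\<lambda>j. m j * (y j \<bullet> y i)^2"]) (auto simp: less_imp_le)
      also have "\<dots> = y i \<bullet> (gram_matrix n m y *v y i)"
        by (simp add: gram_matrix_mult inner_commute[of "y i"] inertia_operator_inner power2_eq_square mult.assoc)
      finally show ?thesis .
    qed
    ultimately have "m i * (y i \<bullet> y i) * (y i \<bullet> y i) \<le> b * (y i \<bullet> y i)"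
      by (simp add: power2_eq_square)
    then have "m i * (y i \<bullet> y i) \<le> b"
      using False mult_le_cancel_right_pos[of "y i \<bullet> y i" "m i * (y i \<bullet> y i)" b] by simp
    then have "(norm (y i))^2 \<le> b / m i"
      using m[OF i] by (simp add: power2_norm_eq_inner field_simps)
    then show ?thesis by (rule real_le_rsqrt)
  qed (use b m[OF i] in simp)
  \<comment> \<open>The distance bound is multiplied out so that it is closed also where points coincide.\<close>
  define P :: "(nat \<Rightarrow> real^'d) set" where "P = {y \<in> ({..<n} \<rightarrow>\<^sub>E UNIV). (\<forall>i<n. norm (y i) \<le> sqrt (b / m i)) \<and> (\<Sum>i<n. m i *\<^sub>R y i) = 0 \<and>
    (\<forall>i<n. \<forall>j<n. i \<noteq> j \<longrightarrow> m i * m j \<le> 2 * ?V x0 * norm (y i - y j))}"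
  have proj: "continuous_map ?X euclidean (\<lambda>y. y i)" if "i < n" for i
    using that by (intro continuous_map_product_projection) auto
  have P_ordered: "(y, m) \<in> ordered_configurations n" if "y \<in> P" for y
  proof -
    have "y i \<noteq> y j" if ij: "i < n" "j < n" "i \<noteq> j" for i j
    proof
      assume "y i = y j"
      moreover have "m i * m j \<le> 2 * ?V x0 * norm (y i - y j)" using \<open>y \<in> P\<close> ij by (auto simp: P_def)
      ultimately have "m i * m j \<le> 0" by simp
      then show False using mult_pos_pos[OF m[OF ij(1)] m[OF ij(2)]] by simp
    qed
    then have "inj_on y {..<n}" by (auto simp: inj_on_def)
    then show ?thesis
      using that ordered_configurationsD(5)[OF x0(1)] by (auto simp: P_def ordered_configurations_def)
  qed
  have in_P: "y \<in> P" if y: "(y, m) \<in> ordered_configurations n" "forget_order n (y, m) \<in> K" "?V y \<le> ?V x0" for y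
  proof -
    have "m i * m j \<le> 2 * ?V x0 * norm (y i - y j)" if ij: "i < n" "j < n" "i \<noteq> j" for i j
    proof -
      have "m i * m j / norm (y i - y j) \<le> (\<Sum>j<n. m i * m j / norm (y i - y j))"
        using ij m by (intro member_le_sum[of j "{..<n}" "\<lambda>j. m i * m j / norm (y i - y j)"]) (auto simp: less_imp_le)
      also have "\<dots> \<le> (\<Sum>i<n. \<Sum>j<n. m i * m j / norm (y i - y j))"
        using ij m by (intro member_le_sum[of i "{..<n}" "\<lambda>i. \<Sum>j<n. m i * m j / norm (y i - y j)"] sum_nonneg)
          (auto simp: less_imp_le)
      also have "\<dots> \<le> 2 * ?V x0" using y(3) by (simp add: pair_potential_def)
      finally have "m i * m j / norm (y i - y j) \<le> 2 * ?V x0" .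
      moreover have "norm (y i - y j) > 0"
        using ordered_configurationsD(1)[OF y(1)] ij by (auto simp: inj_on_def)
      ultimately show ?thesis by (simp add: pos_divide_le_eq)
    qed
    then show ?thesis
      using bounded[OF y(1,2)] y(1) by (auto simp: P_def ordered_configurations_def)
  qed
  have "compactin ?X P"
  proof (rule closed_compactin)
    show "compactin ?X (Pi\<^sub>E {..<n} (\<lambda>i. cball 0 (sqrt (b / m i))))"
      by (simp add: compactin_PiE compactin_euclidean_iff)
    show "P \<subseteq> Pi\<^sub>E {..<n} (\<lambda>i. cball 0 (sqrt (b / m i)))"
      by (auto simp: P_def PiE_def Pi_iff)
    have top: "topspace ?X = {..<n} \<rightarrow>\<^sub>E UNIV" by simp
    have c1: "closedin ?X {y \<in> topspace ?X. norm (y i) \<in> {..sqrt (b / m i)}}" if "i < n" for i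
      using that by (intro closedin_continuous_map_preimage[where Y = euclideanreal] continuous_map_norm proj) auto
    have "continuous_map ?X euclidean (\<lambda>y. m i *\<^sub>R y i)" if "i < n" for i
      using continuous_map_compose[OF proj[OF that], of euclidean "\<lambda>v. m i *\<^sub>R v"]
      by (simp add: comp_def continuous_intros)
    then have c2: "closedin ?X {y \<in> topspace ?X. (\<Sum>i<n. m i *\<^sub>R y i) = 0}"
      by (intro closedin_equalizer_euclidean continuous_map_sum) auto
    have c3: "closedin ?X {y \<in> topspace ?X. 2 * ?V x0 * norm (y i - y j) \<in> {m i * m j..}}" if "i < n" "j < n" for i j
      using that by (intro closedin_continuous_map_preimage[where Y = euclideanreal] continuous_map_real_mult_left
          continuous_map_norm continuous_map_diff proj) auto
    let ?F = "{topspace ?X, {y \<in> topspace ?X. (\<Sum>i<n. m i *\<^sub>R y i) = 0}} \<union>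
        (\<lambda>i. {y \<in> topspace ?X. norm (y i) \<in> {..sqrt (b / m i)}}) ` {..<n} \<union>
        (\<lambda>(i, j). {y \<in> topspace ?X. 2 * ?V x0 * norm (y i - y j) \<in> {m i * m j..}}) ` {(i, j). i < n \<and> j < n \<and> i \<noteq> j}"
    have "closedin ?X (\<Inter>?F)" by (rule closedin_Inter) (use c1 c2 c3 closedin_topspace[of ?X] in auto)
    moreover have "\<Inter>?F = P" unfolding P_def top by (auto simp: PiE_iff extensional_def)
    ultimately show "closedin ?X P" by simp
  qed
  define T where "T = subtopology ?X P"
  have "P \<subseteq> topspace ?X" by (auto simp: P_def PiE_iff extensional_def)
  then have topT: "topspace T = P" by (auto simp: T_def)
  have "compact_space T" unfolding T_def by (rule compact_space_subtopology) fact
  have projT: "continuous_map T euclidean (\<lambda>y. y i)" if "i < n" for i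
    unfolding T_def by (intro continuous_map_from_subtopology proj that)
  have "continuous_map T (config_topology n) (\<lambda>y. forget_order n (y, m))"
    by (rule continuous_map_forget_order[OF projT]) (use P_ordered topT in auto)
  then have "closedin T {y \<in> topspace T. forget_order n (y, m) \<in> K}"
    using closedin_continuous_map_preimage K(1) by blast
  then have comp: "compactin T {y \<in> P. forget_order n (y, m) \<in> K}"
    using closedin_compact_space[OF \<open>compact_space T\<close>] topT by simp
  have "continuous_map T euclideanreal ?V"
  proof -
    have "continuous_map T euclideanreal (\<lambda>y. m i * m j / norm (y i - y j))" if ij: "i < n" "j < n" for i j
    proof (cases "i = j")
      case False
      have "norm (y i - y j) \<noteq> 0" if "y \<in> topspace T" for y
        using ordered_configurationsD(1)[OF P_ordered] that ij False topT by (auto simp: inj_on_def)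
      then show ?thesis
        using ij by (intro continuous_map_real_divide continuous_map_norm continuous_map_diff projT) auto
    qed simp
    then have "continuous_map T euclideanreal (\<lambda>y. inverse 2 * (\<Sum>i<n. \<Sum>j<n. m i * m j / norm (y i - y j)))"
      by (intro continuous_map_real_mult_left continuous_map_sum) auto
    then show ?thesis unfolding pair_potential_def by (simp add: field_simps)
  qed
  from image_compactin[OF comp this] have "compact (?V ` {y \<in> P. forget_order n (y, m) \<in> K})"
    by (simp add: compactin_euclidean_iff)
  moreover have "x0 \<in> {y \<in> P. forget_order n (y, m) \<in> K}" using in_P x0 by simp
  ultimately obtain x where x: "x \<in> P" "forget_order n (x, m) \<in> K"
    and mn: "\<And>y. y \<in> P \<Longrightarrow> forget_order n (y, m) \<in> K \<Longrightarrow> ?V x \<le> ?V y"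
    using compact_attains_inf[of "?V ` {y \<in> P. forget_order n (y, m) \<in> K}"] by blast
  have "?V x \<le> ?V y" if y: "(y, m) \<in> ordered_configurations n" "forget_order n (y, m) \<in> K" for y
  proof (cases "?V y \<le> ?V x0")
    case True
    then show ?thesis using mn in_P y by blast
  next
    case False
    moreover have "?V x \<le> ?V x0" using mn in_P x0 by blast
    ultimately show ?thesis by simp
  qed
  then show ?thesis using that P_ordered x by blast
qed

section \<open>Symmetric criticality\<close>

text \<open>The defect \<open>b\<close> of the claimed symmetry generates a flow inside \<open>K\<close> along which the potential
  would decrease strictly, unless \<open>b = 0\<close>.\<close>

lemma minimizer_repulsion_symmetric:
  fixes G :: "(real^'d^'d) set"
  assumes G: "orthogonal_subgroup G"
    and K: "K \<in> connected_components_of (subtopology (config_topology n) (symmetric_configs_with_spectrum G n \<sigma>))"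
    and xm: "(x, m) \<in> ordered_configurations n" and xK: "forget_order n (x, m) \<in> K"
    and mn: "\<And>y. (y, m) \<in> ordered_configurations n \<Longrightarrow> forget_order n (y, m) \<in> K \<Longrightarrow>
      pair_potential n m x \<le> pair_potential n m y"
    and ij: "i < n" "j < n"
  shows "repulsion n m x j \<bullet> x i = repulsion n m x i \<bullet> x j"
proof -
  let ?Y = "subtopology (config_topology n) (symmetric_configs_with_spectrum G n \<sigma>)"
  note D = ordered_configurationsD[OF xm]
  define a where "a = repulsion n m x"
  define b where "b j i = a j \<bullet> x i - a i \<bullet> x j" for j i
  have skew: "b j i = - b i j" for i j by (simp add: b_def)
  have b_center: "(\<Sum>j<n. m j * b j i) = 0" for i
  proof -
    have "(\<Sum>j<n. m j * b j i) = (\<Sum>j<n. m j *\<^sub>R a j) \<bullet> x i - a i \<bullet> (\<Sum>j<n. m j *\<^sub>R x j)"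
      by (simp add: b_def inner_sum_left inner_sum_right right_diff_distrib sum_subtractf)
    then show ?thesis by (simp add: D(3) a_def total_repulsion_zero)
  qed
  have "K \<subseteq> topspace ?Y" by (rule connected_components_of_subset[OF K])
  then have KS: "K \<subseteq> symmetric_configs_with_spectrum G n \<sigma>" by auto
  then have xS: "forget_order n (x, m) \<in> symmetric_configs_with_spectrum G n \<sigma>" using xK by blast
  then have spec: "spectrum (gram_matrix n m x) = \<sigma>" and
    sym: "\<And>g. g \<in> G \<Longrightarrow> \<exists>\<pi>. bij_betw \<pi> {..<n} {..<n} \<and> (\<forall>i<n. g *v x i = x (\<pi> i) \<and> m (\<pi> i) = m i)"
    using inertia_matrix_ordered[OF xm] symmetric_config_forget_order[OF G xm]
    by (auto simp: symmetric_configs_with_spectrum_def configs_with_spectrum_def inertia_spectrum_def)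
  obtain z where z0: "\<And>j. z 0 j = x j" and z: "flows_by n m b z"
    using flow_exists[of x n m b] by blast
  \<comment> \<open>The symmetry \<open>g\<close> and the relabelling \<open>\<pi>\<close> give two solutions with the same initial value.\<close>
  have zeq: "\<exists>\<pi>. bij_betw \<pi> {..<n} {..<n} \<and> (\<forall>i<n. g *v z t i = z t (\<pi> i) \<and> m (\<pi> i) = m i)"
    if g: "g \<in> G" for g t
  proof -
    obtain \<pi> where \<pi>: "bij_betw \<pi> {..<n} {..<n}" "\<And>i. i < n \<Longrightarrow> g *v x i = x (\<pi> i)"
      "\<And>i. i < n \<Longrightarrow> m (\<pi> i) = m i" using sym[OF g] by blast
    have lt: "\<pi> i < n" if "i < n" for i using \<pi>(1) that by (auto simp: bij_betw_def)
    have orth: "orthogonal_transformation ((*v) g)"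
      using G g by (auto simp: orthogonal_subgroup_def orthogonal_transformation_matrix)
    have "a (\<pi> i) = g *v a i" if "i < n" for i
      unfolding a_def by (rule repulsion_equivariant[OF matrix_vector_mul_linear _ \<pi>(1)])
        (use \<pi> that orthogonal_subgroup_matrix_inv(4)[OF G g] in auto)
    then have binv: "b (\<pi> j) (\<pi> i) = b j i" if "i < n" "j < n" for i j
      using that orth by (simp add: b_def orthogonal_transformation_def flip: \<pi>(2))
    have flow1: "flows_by n m b (\<lambda>t j. g *v z t j)"
      by (rule flows_by_linear_image[OF z matrix_vector_mul_bounded_linear])
    have flow2: "flows_by n m b (\<lambda>t j. z t (\<pi> j))"
      using flows_by_reindex[OF z \<pi>(1)] \<pi>(3) binv by blast
    have init: "g *v z 0 j = z 0 (\<pi> j)" if "j < n" for j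
      using \<pi>(2)[OF that] by (simp only: z0)
    have "g *v z t i = z t (\<pi> i)" if "i < n" for i
      by (rule flow_unique[OF flow1 flow2 skew D(2) init that])
    then show ?thesis using \<pi> by blast
  qed
  have cont: "isCont (\<lambda>t. z t i) t" if "i < n" for i t
    using z that has_vector_derivative_continuous unfolding flows_by_def by blast
  have "eventually (\<lambda>t. \<forall>i\<in>{..<n}. \<forall>j\<in>{..<n}. i \<noteq> j \<longrightarrow> z t i \<noteq> z t j) (at 0)"
  proof (intro eventually_ball_finite finite_lessThan ballI)
    fix i j assume ij: "i \<in> {..<n}" "j \<in> {..<n}"
    show "eventually (\<lambda>t. i \<noteq> j \<longrightarrow> z t i \<noteq> z t j) (at 0)"
    proof (cases "i = j")
      case False
      then have "z 0 i - z 0 j \<noteq> 0" using D(1) ij z0 by (auto simp: inj_on_def)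
      moreover have "((\<lambda>t. z t i - z t j) \<longlongrightarrow> z 0 i - z 0 j) (at 0)"
        using cont ij by (intro tendsto_diff) (auto simp: isCont_def)
      ultimately have "eventually (\<lambda>t. z t i - z t j \<noteq> 0) (at 0)" by (rule tendsto_imp_eventually_ne[rotated])
      then show ?thesis by (rule eventually_mono) auto
    qed simp
  qed
  then obtain e where e: "e > 0" and ne: "\<And>t i j. t \<noteq> 0 \<Longrightarrow> \<bar>t\<bar> < e \<Longrightarrow> i < n \<Longrightarrow> j < n \<Longrightarrow> i \<noteq> j \<Longrightarrow> z t i \<noteq> z t j"
    by (auto simp: eventually_at dist_real_def)
  \<comment> \<open>Ordered configurations take the value \<^const>\<open>undefined\<close> beyond index \<open>n\<close>.\<close>
  define y where "y t = restrict (z t) {..<n}" for t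
  have inj: "inj_on (y t) {..<n}" if "\<bar>t\<bar> < e" for t
    using ne[OF _ that] D(1) by (cases "t = 0") (auto simp: y_def inj_on_def z0)
  have yO: "(y t, m) \<in> ordered_configurations n" if "\<bar>t\<bar> < e" for t
  proof -
    have "(\<Sum>j<n. m j *\<^sub>R z t j) = 0"
      using flow_conserves_weighted_sum[OF z b_center, of t] z0 D(3) by simp
    then show ?thesis
      using inj[OF that] D(5) by (auto simp: ordered_configurations_def y_def)
  qed
  have yS: "forget_order n (y t, m) \<in> symmetric_configs_with_spectrum G n \<sigma>" if "\<bar>t\<bar> < e" for t
  proof -
    have "gram_matrix n m (y t) = gram_matrix n m (z t)" by (simp add: gram_matrix_def y_def)
    also have "\<dots> = gram_matrix n m x"
      using flow_conserves_gram_matrix[OF z skew, of t] z0 by (simp add: gram_matrix_def)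
    finally have "inertia_spectrum (forget_order n (y t, m)) = \<sigma>"
      using inertia_matrix_ordered[OF yO[OF that]] spec by (simp add: inertia_spectrum_def)
    moreover have "symmetric_config G (forget_order n (y t, m))"
      unfolding symmetric_config_forget_order[OF G yO[OF that]]
    proof
      fix g assume "g \<in> G"
      then obtain \<pi> where "bij_betw \<pi> {..<n} {..<n}" "\<forall>i<n. g *v z t i = z t (\<pi> i) \<and> m (\<pi> i) = m i"
        using zeq by blast
      then show "\<exists>\<pi>. bij_betw \<pi> {..<n} {..<n} \<and> (\<forall>i<n. g *v y t i = y t (\<pi> i) \<and> m (\<pi> i) = m i)"
        by (intro exI[of _ \<pi>]) (auto simp: y_def bij_betw_def)
    qed
    ultimately show ?thesis
      using forget_order_in_configurations[OF yO[OF that]]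
      by (simp add: symmetric_configs_with_spectrum_def configs_with_spectrum_def)
  qed
  let ?I = "top_of_set {-e<..<e}"
  have "continuous_map ?I (config_topology n) (\<lambda>t. forget_order n (y t, m))"
  proof (rule continuous_map_forget_order)
    show "continuous_map ?I euclidean (\<lambda>t. y t i)" if "i < n" for i
      using that cont by (auto simp: y_def intro!: continuous_at_imp_continuous_on)
  qed (use yO in auto)
  then have "connectedin (config_topology n) ((\<lambda>t. forget_order n (y t, m)) ` {-e<..<e})"
    by (rule connectedin_continuous_map_image) (simp add: connectedin_subtopology)
  then have "connectedin ?Y ((\<lambda>t. forget_order n (y t, m)) ` {-e<..<e})"
    using yS by (auto simp: connectedin_subtopology)
  moreover have y0: "y 0 = x" using D(4) z0 by (auto simp: y_def fun_eq_iff extensional_def)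
  then have "forget_order n (x, m) \<in> (\<lambda>t. forget_order n (y t, m)) ` {-e<..<e}"
    using e by (intro image_eqI[of _ _ 0]) auto
  then have "\<not> disjnt K ((\<lambda>t. forget_order n (y t, m)) ` {-e<..<e})"
    using xK unfolding disjnt_def by blast
  ultimately have yK: "forget_order n (y t, m) \<in> K" if "\<bar>t\<bar> < e" for t
    using connected_components_of_maximal[OF K] that by fastforce
  have V: "pair_potential n m (y t) = pair_potential n m (z t)" for t
    by (simp add: pair_potential_def y_def)
  let ?D = "- (\<Sum>j<n. m j * (repulsion n m (z 0) j \<bullet> (\<Sum>i<n. (m i * b j i) *\<^sub>R z 0 i)))"
  have "((\<lambda>t. pair_potential n m (z t)) has_real_derivative ?D) (at 0)"
  proof (rule pair_potential_has_derivative)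
    show "((\<lambda>t. z t j) has_vector_derivative (\<Sum>i<n. (m i * b j i) *\<^sub>R z 0 i)) (at 0)" if "j < n" for j
      using z that unfolding flows_by_def by blast
    show "inj_on (z 0) {..<n}" using D(1) z0 by (simp add: inj_on_def)
  qed
  moreover have "\<forall>t. \<bar>0 - t\<bar> < e \<longrightarrow> pair_potential n m (z 0) \<le> pair_potential n m (z t)"
  proof (intro allI impI)
    fix t :: real assume "\<bar>0 - t\<bar> < e"
    then have t: "\<bar>t\<bar> < e" by simp
    show "pair_potential n m (z 0) \<le> pair_potential n m (z t)"
      using mn[OF yO[OF t] yK[OF t]] V[of 0] V[of t] y0 by simp
  qed
  ultimately have "?D = 0" using DERIV_local_min e by blast
  moreover have "repulsion n m (z 0) = a" using z0 by (simp add: a_def repulsion_def fun_eq_iff)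
  ultimately have s1: "(\<Sum>j<n. \<Sum>i<n. m j * m i * b j i * (a j \<bullet> x i)) = 0"
    using z0 by (simp add: inner_sum_right sum_distrib_left mult.assoc)
  have "(\<Sum>j<n. \<Sum>i<n. m j * m i * b j i * (a j \<bullet> x i)) = (\<Sum>j<n. \<Sum>i<n. m i * m j * b i j * (a i \<bullet> x j))"
    by (rule sum.swap)
  also have "\<dots> = (\<Sum>j<n. \<Sum>i<n. - (m j * m i * b j i * (a i \<bullet> x j)))"
    by (intro sum.cong refl, subst skew) simp
  finally have s2: "(\<Sum>j<n. \<Sum>i<n. - (m j * m i * b j i * (a i \<bullet> x j))) = 0" using s1 by simp
  have "(\<Sum>j<n. \<Sum>i<n. m j * m i * (b j i)^2) =
      (\<Sum>j<n. \<Sum>i<n. m j * m i * b j i * (a j \<bullet> x i)) + (\<Sum>j<n. \<Sum>i<n. - (m j * m i * b j i * (a i \<bullet> x j)))"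
    unfolding sum.distrib[symmetric]
    by (intro sum.cong refl) (simp add: b_def power2_eq_square algebra_simps)
  also have "\<dots> = 0" using s1 s2 by simp
  finally have "(\<Sum>j<n. \<Sum>i<n. m j * m i * (b j i)^2) = 0" .
  then have "(\<Sum>i<n. m j * m i * (b j i)^2) = 0"
    using ij D(2) by (subst (asm) sum_nonneg_eq_0_iff) (auto intro!: sum_nonneg simp: less_imp_le)
  then have "m j * m i * (b j i)^2 = 0"
    using ij D(2) by (subst (asm) sum_nonneg_eq_0_iff) (auto simp: less_imp_le)
  then have "b j i = 0" using D(2)[OF ij(1)] D(2)[OF ij(2)] by simp
  then show ?thesis by (simp add: b_def a_def)
qed

text \<open>The masses of the minimiser are fixed by choosing an ordering of one configuration in \<open>K\<close>. A test curve
  brings its own ordering of the minimiser, to which minimality is carried over by a permutation.\<close>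

lemma symmetric_component_has_balanced:
  fixes G :: "(real^'d^'d) set"
  assumes G: "orthogonal_subgroup G" "finite G"
    and K: "K \<in> connected_components_of (subtopology (config_topology n) (symmetric_configs_with_spectrum G n \<sigma>))"
  shows "\<exists>c\<in>K. balanced n c"
proof -
  let ?Y = "subtopology (config_topology n) (symmetric_configs_with_spectrum G n \<sigma>)"
  have "K \<subseteq> topspace ?Y" by (rule connected_components_of_subset[OF K])
  then have KS: "K \<subseteq> symmetric_configs_with_spectrum G n \<sigma>" by auto
  then have K\<sigma>: "K \<subseteq> configs_with_spectrum n \<sigma>" by (auto simp: symmetric_configs_with_spectrum_def)
  have Kclosed: "closedin (config_topology n) K"
    using closedin_trans_full[OF closedin_connected_components_of[OF K]
        closedin_symmetric_configs_with_spectrum[OF G]] .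
  obtain c0 where c0: "c0 \<in> K" using nonempty_connected_components_of[OF K] by blast
  then have "c0 \<in> configurations n" using K\<sigma> by (auto simp: configs_with_spectrum_def)
  then obtain p where p: "p \<in> ordered_configurations n" "forget_order n p = c0"
    using forget_order_surj by blast
  obtain x0 m where "p = (x0, m)" by fastforce
  with c0 p obtain x where x: "(x, m) \<in> ordered_configurations n" "forget_order n (x, m) \<in> K"
    and mn: "\<And>y. (y, m) \<in> ordered_configurations n \<Longrightarrow> forget_order n (y, m) \<in> K \<Longrightarrow>
      pair_potential n m x \<le> pair_potential n m y"
    using potential_attains_minimum[OF Kclosed K\<sigma>, of x0 m] by blast
  define c where "c = forget_order n (x, m)"
  have c\<sigma>: "c \<in> configs_with_spectrum n \<sigma>" using x K\<sigma> by (auto simp: c_def)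
  then have spec: "inertia_spectrum c = \<sigma>" by (auto simp: configs_with_spectrum_def)
  have "((\<lambda>t. potential (forget_order n (\<gamma> t, m'))) has_real_derivative 0) (at 0)"
    if e: "0 < e" and \<gamma>: "\<And>t. \<bar>t\<bar> < e \<Longrightarrow> (\<gamma> t, m') \<in> ordered_configurations n \<and>
        forget_order n (\<gamma> t, m') \<in> configs_with_spectrum n \<sigma>"
      and \<gamma>0: "forget_order n (\<gamma> 0, m') = c"
      and C1: "\<And>i. i < n \<Longrightarrow> (\<lambda>t. \<gamma> t i) C1_differentiable_on {-e<..<e}"
    for m' \<gamma> e
  proof -
    have \<gamma>0O: "(\<gamma> 0, m') \<in> ordered_configurations n" using \<gamma>[of 0] e by simp
    note D = ordered_configurationsD[OF \<gamma>0O]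
    obtain \<tau> where \<tau>: "bij_betw \<tau> {..<n} {..<n}" "\<And>i. i < n \<Longrightarrow> x i = \<gamma> 0 (\<tau> i)" "\<And>i. i < n \<Longrightarrow> m i = m' (\<tau> i)"
      using forget_order_eq_imp_permuted[OF \<gamma>0O x(1)] \<gamma>0 by (auto simp: c_def)
    have m\<tau>: "restrict (m' \<circ> \<tau>) {..<n} = m"
      using ordered_configurationsD(5)[OF x(1)] \<tau>(3) by (auto simp: fun_eq_iff PiE_iff extensional_def)
    have mn': "pair_potential n m' (\<gamma> 0) \<le> pair_potential n m' y"
      if y: "(y, m') \<in> ordered_configurations n" "forget_order n (y, m') \<in> K" for y
    proof -
      note p = permuted_ordered_configuration[OF y(1) \<tau>(1), unfolded m\<tau>]
      have "pair_potential n m x \<le> pair_potential n m (restrict (y \<circ> \<tau>) {..<n})"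
        using mn[OF p(1)] p(2) y(2) by simp
      then show ?thesis
        using potential_forget_order[OF p(1)] potential_forget_order[OF y(1)] p(2)
          potential_forget_order[OF \<gamma>0O] potential_forget_order[OF x(1)] \<gamma>0 by (simp add: c_def)
    qed
    have sym1: "repulsion n m' (\<gamma> 0) j \<bullet> \<gamma> 0 i = repulsion n m' (\<gamma> 0) i \<bullet> \<gamma> 0 j" if "i < n" "j < n" for i j
      by (rule minimizer_repulsion_symmetric[OF G(1) K \<gamma>0O _ mn' that]) (use x(2) \<gamma>0 in \<open>auto simp: c_def\<close>)
    have "\<forall>i\<in>{..<n}. \<exists>v. ((\<lambda>t. \<gamma> t i) has_vector_derivative v) (at 0)"
      using C1 e unfolding C1_differentiable_on_def by fastforce
    then obtain v where v: "\<And>i. i < n \<Longrightarrow> ((\<lambda>t. \<gamma> t i) has_vector_derivative v i) (at 0)"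
      by (metis lessThan_iff)
    have "(\<Sum>j<n. m' j * (repulsion n m' (\<gamma> 0) j \<bullet> v j)) = 0"
    proof (rule isospectral_first_variation[OF D(2) v e _ sym1 repulsion_torque_symmetric])
      fix t :: real assume t: "\<bar>t\<bar> < e"
      show "spectrum (gram_matrix n m' (\<gamma> t)) = \<sigma>"
        using \<gamma>[OF t] inertia_matrix_ordered[of "\<gamma> t" m' n]
        by (auto simp: configs_with_spectrum_def inertia_spectrum_def)
    qed
    then have "((\<lambda>t. pair_potential n m' (\<gamma> t)) has_real_derivative 0) (at 0)"
      using pair_potential_has_derivative[where m = m', OF v D(1)] by simp
    moreover have "pair_potential n m' (\<gamma> t) = potential (forget_order n (\<gamma> t, m'))" if "t \<in> {-e<..<e}" for t
    proof -
      have "\<bar>t\<bar> < e" using that by auto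
      then show ?thesis using \<gamma>[of t] by (simp add: potential_forget_order)
    qed
    ultimately show ?thesis
      using has_field_derivative_transform_within_open[of "\<lambda>t. pair_potential n m' (\<gamma> t)" 0 0 "{-e<..<e}"] e by auto
  qed
  then have "balanced n c"
    unfolding balanced_def critical_point_def spec using c\<sigma> by (auto simp: abs_less_iff)
  then show ?thesis using x(2) c_def by blast
qed


section \<open>The Burnside type is locally constant\<close>

lemma orbit_eq_iff:
  assumes G: "orthogonal_subgroup G"
  shows "orbit G p = orbit G q \<longleftrightarrow> (\<exists>g\<in>G. g *v p = q)"
proof
  have "q \<in> orbit G q"
    unfolding orbit_def using G by (intro image_eqI[of _ _ "mat 1"]) (auto simp: orthogonal_subgroup_def)
  then show "\<exists>g\<in>G. g *v p = q" if "orbit G p = orbit G q"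
    using that unfolding orbit_def by (metis imageE)
  have sub: "orbit G (g *v p) \<subseteq> orbit G p" if "g \<in> G" for g p
    using that G by (auto simp: orbit_def orthogonal_subgroup_def matrix_vector_mul_assoc)
  show "orbit G p = orbit G q" if "\<exists>g\<in>G. g *v p = q"
  proof -
    from that obtain g where g: "g \<in> G" "q = g *v p" by blast
    note inv = orthogonal_subgroup_matrix_inv[OF G g(1)]
    show ?thesis using sub[OF g(1), of p] sub[OF inv(1), of q] inv(2) g(2) by auto
  qed
qed

text \<open>The image of the segment in the orbit space is connected, and it stays inside the stratum of the
  orbit type because the stabiliser does not change.\<close>

lemma orbit_in_component_constant_stabilizer:
  fixes G :: "(real^'d^'d) set"
  assumes G: "orthogonal_subgroup G"
    and stab: "\<And>z. z \<in> closed_segment p q \<Longrightarrow> stabilizer G z = stabilizer G p"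
    and A: "A \<in> connected_components_of (subtopology (orbit_space G) (orbits_of_type G H))"
    and pA: "orbit G p \<in> A"
  shows "orbit G q \<in> A"
proof -
  let ?S = "orbits_of_type G H"
  have "A \<subseteq> topspace (subtopology (orbit_space G) ?S)" by (rule connected_components_of_subset[OF A])
  then have "orbit G p \<in> ?S" using pA by auto
  then obtain p' where p': "orbit G p = orbit G p'" "stabilizer G p' \<in> conj_class G H"
    by (auto simp: orbits_of_type_def)
  then obtain g where g: "g \<in> G" "g *v p = p'" using orbit_eq_iff[OF G] by blast
  \<comment> \<open>The orbit of \<open>p\<close> has a representative \<open>g p\<close> with stabiliser in the given class; each \<open>z\<close> on the segment
    is moved by the same \<open>g\<close>.\<close>
  note inv = orthogonal_subgroup_matrix_inv[OF G g(1)]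
  have conj: "stabilizer G (g *v z) = {h \<in> G. (matrix_inv g ** h ** g) *v z = z}" for z
  proof -
    have "h *v (g *v z) = g *v z \<longleftrightarrow> matrix_inv g *v (h *v (g *v z)) = z" for h
      using inv(2,3) by metis
    then show ?thesis by (simp add: stabilizer_def matrix_vector_mul_assoc matrix_mul_assoc)
  qed
  have sub: "orbit G ` closed_segment p q \<subseteq> ?S"
  proof
    fix O' assume "O' \<in> orbit G ` closed_segment p q"
    then obtain z where z: "z \<in> closed_segment p q" "O' = orbit G z" by blast
    have inG: "matrix_inv g ** h ** g \<in> G" if "h \<in> G" for h
      using G g(1) inv(1) that by (auto simp: orthogonal_subgroup_def)
    have "stabilizer G (g *v z) = stabilizer G (g *v p)"
      using stab[OF z(1)] inG unfolding conj by (auto simp: stabilizer_def)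
    then have "stabilizer G (g *v z) \<in> conj_class G H" using p'(2) g(2) by simp
    moreover have "O' = orbit G (g *v z)" using orbit_eq_iff[OF G, of z "g *v z"] g(1) z(2) by auto
    ultimately show "O' \<in> ?S" by (auto simp: orbits_of_type_def)
  qed
  have "continuous_map euclidean (orbit_space G) (orbit G)"
    unfolding orbit_space_def by (rule quotient_imp_continuous_map[OF quotient_map_quotient_topology])
  then have "connectedin (orbit_space G) (orbit G ` closed_segment p q)"
    by (rule connectedin_continuous_map_image) simp
  then have "connectedin (subtopology (orbit_space G) ?S) (orbit G ` closed_segment p q)"
    using sub by (simp add: connectedin_subtopology)
  moreover have "\<not> disjnt A (orbit G ` closed_segment p q)"
    using pA by (auto simp: disjnt_iff)
  ultimately have "orbit G ` closed_segment p q \<subseteq> A"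
    by (rule connected_components_of_maximal[OF A])
  then show ?thesis by auto
qed

lemma card_image_cong_kernel:
  assumes "\<And>i j. i \<in> I \<Longrightarrow> j \<in> I \<Longrightarrow> f i = f j \<longleftrightarrow> g i = g j"
  shows "card (f ` I) = card (g ` I)"
proof (rule bij_betw_same_card)
  let ?h = "g \<circ> inv_into I f"
  have h: "?h (f i) = g i" if "i \<in> I" for i
    using that assms[of "inv_into I f (f i)" i] by (simp add: inv_into_into f_inv_into_f)
  show "bij_betw ?h (f ` I) (g ` I)"
  proof (rule bij_betw_imageI)
    show "inj_on ?h (f ` I)"
    proof (rule inj_onI)
      fix u v assume uv: "u \<in> f ` I" "v \<in> f ` I" "?h u = ?h v"
      then obtain i j where "i \<in> I" "u = f i" "j \<in> I" "v = f j" by blast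
      then show "u = v" using uv(3) h assms[of i j] by simp
    qed
    show "?h ` f ` I = g ` I" unfolding image_image using h by (rule image_cong[OF refl])
  qed
qed

text \<open>Since \<open>2 r\<close> is a lower bound for the nonzero distances between \<open>g x\<^sub>i\<close> and \<open>x\<^sub>j\<close>, a displacement by less than \<open>r\<close>
  creates no new coincidence between \<open>g y\<^sub>i\<close> and \<open>y\<^sub>j\<close>. It destroys none either: \<open>g y\<^sub>i\<close> must be some point \<open>y\<^sub>k\<close>, and
  then \<open>g x\<^sub>i = x\<^sub>k\<close>. So the identification of points in orbits and all stabilisers agree, even along the
  segments from \<open>x\<^sub>i\<close> to \<open>y\<^sub>i\<close>.\<close>

lemma nearby_symmetric_config_same_Burnside_type:
  fixes G :: "(real^'d^'d) set"
  assumes G: "orthogonal_subgroup G"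
    and xm: "(x, m) \<in> ordered_configurations n" and ym: "(y, m') \<in> ordered_configurations n"
    and symx: "symmetric_config G (forget_order n (x, m))"
    and symy: "symmetric_config G (forget_order n (y, m'))"
    and r: "\<And>g i j. g \<in> G \<Longrightarrow> i < n \<Longrightarrow> j < n \<Longrightarrow> g *v x i \<noteq> x j \<Longrightarrow> 2 * r \<le> norm (g *v x i - x j)"
    and near: "\<And>i. i < n \<Longrightarrow> norm (y i - x i) < r"
  shows "has_Burnside_type G (forget_order n (x, m)) \<Gamma> \<longleftrightarrow> has_Burnside_type G (forget_order n (y, m')) \<Gamma>"
proof -
  have close: "g *v x i = x j" if "g \<in> G" "i < n" "j < n" "norm (z - x i) < r" "norm (g *v z - x j) < r" for g i j z
  proof (rule ccontr)
    assume "g *v x i \<noteq> x j"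
    then have "2 * r \<le> norm (g *v x i - x j)" using r that by blast
    also have "\<dots> \<le> norm (g *v z - x j) + norm (g *v (z - x i))"
      using norm_triangle_ineq4[of "g *v z - x j" "g *v (z - x i)"] by (simp add: matrix_vector_mult_diff_distrib)
    also have "norm (g *v (z - x i)) = norm (z - x i)" using orthogonal_subgroup_matrix_inv(4)[OF G that(1)] .
    finally show False using that by simp
  qed
  have one: "mat 1 \<in> G" using G by (simp add: orthogonal_subgroup_def)
  have same: "g *v y i = y j \<longleftrightarrow> g *v x i = x j" if g: "g \<in> G" and ij: "i < n" "j < n" for g i j
  proof
    show "g *v x i = x j" if "g *v y i = y j" using close[OF g ij near] near ij that by simp
    assume gx: "g *v x i = x j"
    obtain \<pi> where \<pi>: "bij_betw \<pi> {..<n} {..<n}" "\<And>i. i < n \<Longrightarrow> g *v y i = y (\<pi> i)"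
      using symy g unfolding symmetric_config_forget_order[OF G ym] by blast
    define k where "k = \<pi> i"
    have k: "k < n" "g *v y i = y k" using \<pi> ij(1) by (auto simp: k_def bij_betw_def)
    then have "x k = g *v x i" using close[OF g ij(1) k(1) near] near ij by simp
    then have "k = j" using gx ordered_configurationsD(1)[OF xm] k(1) ij by (auto simp: inj_on_def)
    then show "g *v y i = y j" using k by simp
  qed
  have stab: "stabilizer G z = stabilizer G (x i)" if i: "i < n" and z: "z \<in> closed_segment (x i) (y i)" for i z
  proof -
    obtain u where u: "0 \<le> u" "u \<le> 1" "z = (1 - u) *\<^sub>R x i + u *\<^sub>R y i" using z by (auto simp: in_segment)
    have "z - x i = u *\<^sub>R (y i - x i)" by (simp add: u(3) algebra_simps)
    then have "norm (z - x i) \<le> norm (y i - x i)" using u by (simp add: mult_left_le_one_le)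
    then have zr: "norm (z - x i) < r" using near[OF i] by simp
    have "g *v z = z \<longleftrightarrow> g *v x i = x i" if g: "g \<in> G" for g
    proof
      show "g *v x i = x i" if "g *v z = z" using close[OF g i i zr] zr that by simp
      assume "g *v x i = x i"
      moreover then have "g *v y i = y i" using same[OF g i i] by simp
      ultimately show "g *v z = z"
        by (simp add: u(3) matrix_vector_right_distrib matrix_vector_mult_scaleR)
    qed
    then show ?thesis by (auto simp: stabilizer_def)
  qed
  have orb: "orbit G (x i) = orbit G (x j) \<longleftrightarrow> orbit G (y i) = orbit G (y j)" if "i < n" "j < n" for i j
    using same that unfolding orbit_eq_iff[OF G] by blast
  have "card (orbit G ` x ` {..<n} \<inter> A) = card (orbit G ` y ` {..<n} \<inter> A)"
    if KA: "(K, A) \<in> topological_types G" for K A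
  proof -
    obtain H where A: "A \<in> connected_components_of (subtopology (orbit_space G) (orbits_of_type G H))"
      using KA by (auto simp: topological_types_def)
    have iff: "orbit G (x i) \<in> A \<longleftrightarrow> orbit G (y i) \<in> A" if "i < n" for i
    proof
      show "orbit G (y i) \<in> A" if "orbit G (x i) \<in> A"
        using orbit_in_component_constant_stabilizer[OF G stab A that] \<open>i < n\<close> by blast
      have "stabilizer G z = stabilizer G (y i)" if "z \<in> closed_segment (y i) (x i)" for z
        using stab[OF \<open>i < n\<close>, of z] stab[OF \<open>i < n\<close>, of "y i"] that by (simp add: closed_segment_commute)
      then show "orbit G (x i) \<in> A" if "orbit G (y i) \<in> A"
        using orbit_in_component_constant_stabilizer[OF G _ A that] by blast
    qed
    let ?I = "{i. i < n \<and> orbit G (x i) \<in> A}"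
    have "orbit G ` x ` {..<n} \<inter> A = (\<lambda>i. orbit G (x i)) ` ?I" by auto
    moreover have "orbit G ` y ` {..<n} \<inter> A = (\<lambda>i. orbit G (y i)) ` ?I" using iff by auto
    moreover have "card ((\<lambda>i. orbit G (x i)) ` ?I) = card ((\<lambda>i. orbit G (y i)) ` ?I)"
      by (rule card_image_cong_kernel) (use orb in auto)
    ultimately show ?thesis by simp
  qed
  then show ?thesis unfolding has_Burnside_type_def by (auto split: prod.splits)
qed

lemma Burnside_type_locally_constant:
  fixes G :: "(real^'d^'d) set"
  assumes G: "orthogonal_subgroup G" "finite G"
    and xm: "(x, m) \<in> ordered_configurations n"
    and symx: "symmetric_config G (forget_order n (x, m))"
  shows "\<exists>U. openin (ordered_topology n) U \<and> (x, m) \<in> U \<and> (\<forall>p\<in>U. symmetric_config G (forget_order n p) \<longrightarrow>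
    (has_Burnside_type G (forget_order n p) \<Gamma> \<longleftrightarrow> has_Burnside_type G (forget_order n (x, m)) \<Gamma>))"
proof -
  define D where "D = (\<lambda>(g, i, j). norm (g *v x i - x j)) ` {(g, i, j). g \<in> G \<and> i < n \<and> j < n \<and> g *v x i \<noteq> x j}"
  have "finite {(g, i, j). g \<in> G \<and> i < n \<and> j < n \<and> g *v x i \<noteq> x j}"
    by (rule finite_subset[of _ "G \<times> {..<n} \<times> {..<n}"]) (use G in auto)
  then have D: "finite D" "\<And>d. d \<in> D \<Longrightarrow> d > 0" by (auto simp: D_def)
  define r where "r = Min (insert 1 D) / 2"
  have r0: "r > 0" using D by (auto simp: r_def)
  have r: "2 * r \<le> norm (g *v x i - x j)" if "g \<in> G" "i < n" "j < n" "g *v x i \<noteq> x j" for g i j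
  proof -
    have "norm (g *v x i - x j) \<in> D" using that by (force simp: D_def)
    then show ?thesis using D(1) by (simp add: r_def)
  qed
  define U where "U = (\<Inter>i\<in>{..<n}. {p \<in> topspace (ordered_topology n). fst p i \<in> ball (x i) r}) \<inter> topspace (ordered_topology n)"
  have "openin (ordered_topology n) {p \<in> topspace (ordered_topology n). fst p i \<in> ball (x i) r}" if "i < n" for i
    by (rule openin_continuous_map_preimage[OF continuous_map_position[OF that]]) simp
  then have "openin (ordered_topology n) U"
    by (cases "n = 0") (auto simp: U_def intro!: openin_Int openin_INT2)
  moreover have "(x, m) \<in> U" using xm r0 by (simp add: U_def topspace_ordered_topology)
  moreover have "has_Burnside_type G (forget_order n p) \<Gamma> \<longleftrightarrow> has_Burnside_type G (forget_order n (x, m)) \<Gamma>"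
    if p: "p \<in> U" "symmetric_config G (forget_order n p)" for p
  proof -
    obtain y m' where ym: "p = (y, m')" by fastforce
    have "norm (y i - x i) < r" if "i < n" for i
      using p(1) that by (auto simp: U_def ym dist_norm norm_minus_commute)
    moreover have "(y, m') \<in> ordered_configurations n" using p(1) by (simp add: U_def ym topspace_ordered_topology)
    ultimately show ?thesis
      using nearby_symmetric_config_same_Burnside_type[OF G(1) xm _ symx _ r] p(2) by (simp add: ym)
  qed
  ultimately show ?thesis by blast
qed

text \<open>Local constancy holds in ordered configurations. It descends because \<open>forget_order\<close> restricts to a
  quotient map over the closed set of symmetric configurations, and makes each type clopen there.\<close>

lemma Burnside_type_constant_on_connected:
  fixes G :: "(real^'d^'d) set"
  assumes G: "orthogonal_subgroup G" "finite G"
    and K: "connectedin (config_topology n) K" "\<And>c. c \<in> K \<Longrightarrow> symmetric_config G c"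
    and c: "c \<in> K" "c' \<in> K" "has_Burnside_type G c \<Gamma>"
  shows "has_Burnside_type G c' \<Gamma>"
proof -
  define S :: "'d config set" where "S = {c \<in> configurations n. symmetric_config G c}"
  define SO :: "'d ordered_config set" where "SO = {p \<in> topspace (ordered_topology n). forget_order n p \<in> S}"
  let ?W = "\<lambda>B. {c \<in> S. has_Burnside_type G c \<Gamma> = B}"
  have topO: "topspace (subtopology (ordered_topology n) SO) = SO" by (auto simp: SO_def)
  have topC: "topspace (subtopology (config_topology n) S) = S"
    by (auto simp: S_def topspace_config_topology)
  have quo: "quotient_map (subtopology (ordered_topology n) SO) (subtopology (config_topology n) S) (forget_order n)"
    by (rule quotient_map_restriction[OF quotient_map_forget_order])
      (use closedin_symmetric_configs[OF G] in \<open>auto simp: S_def SO_def\<close>)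
  have pre: "openin (subtopology (ordered_topology n) SO) {p \<in> SO. forget_order n p \<in> ?W B}" for B
  proof (subst openin_subopen, intro ballI)
    fix p assume p: "p \<in> {p \<in> SO. forget_order n p \<in> ?W B}"
    obtain x m where xm: "p = (x, m)" by fastforce
    obtain U where U: "openin (ordered_topology n) U" "p \<in> U"
      "\<And>q. q \<in> U \<Longrightarrow> symmetric_config G (forget_order n q) \<Longrightarrow>
        has_Burnside_type G (forget_order n q) \<Gamma> \<longleftrightarrow> has_Burnside_type G (forget_order n p) \<Gamma>"
      using Burnside_type_locally_constant[OF G, of x m n \<Gamma>] p
      by (auto simp: xm SO_def S_def topspace_ordered_topology)
    have "openin (subtopology (ordered_topology n) SO) (SO \<inter> U)"
      using openin_subtopology_Int2[OF U(1)] .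
    moreover have "SO \<inter> U \<subseteq> {p \<in> SO. forget_order n p \<in> ?W B}"
      using U(3) p by (auto simp: SO_def S_def)
    ultimately show "\<exists>T. openin (subtopology (ordered_topology n) SO) T \<and> p \<in> T \<and> T \<subseteq> {p \<in> SO. forget_order n p \<in> ?W B}"
      using p U(2) by (intro exI[of _ "SO \<inter> U"]) auto
  qed
  have op: "openin (subtopology (config_topology n) S) (?W B)" for B
  proof -
    have "?W B \<subseteq> topspace (subtopology (config_topology n) S)" unfolding topC by blast
    from conjunct2[OF quo[unfolded quotient_map_def], rule_format, OF this] pre[of B]
    show ?thesis unfolding topO by simp
  qed
  have "S - ?W True = ?W False" by auto
  then have "closedin (subtopology (config_topology n) S) (?W True)"
    using op[of False] unfolding closedin_def topC by auto
  moreover have "K \<subseteq> S"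
    using K connectedin_subset_topspace[OF K(1)] by (auto simp: S_def topspace_config_topology)
  then have "connectedin (subtopology (config_topology n) S) K" using K(1) by (simp add: connectedin_subtopology)
  ultimately have "K \<subseteq> ?W True \<or> disjnt K (?W True)"
    using connectedin_clopen_cases op by blast
  then show ?thesis using c \<open>K \<subseteq> S\<close> unfolding disjnt_def by blast
qed


section \<open>Symmetric balanced configurations\<close>

theorem theorem12:
  fixes G :: "(real^'d^'d) set" and \<sigma> :: "real multiset" and n :: nat
  assumes "finite G" and "orthogonal_subgroup G"
    and "\<exists>c\<in>configurations n. symmetric_config G c \<and> inertia_spectrum c = \<sigma>"
  shows "symmetric_configs_with_spectrum G n \<sigma> \<noteq> {} \<and>
    closedin (subtopology (config_topology n) (configs_with_spectrum n \<sigma>))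
      (symmetric_configs_with_spectrum G n \<sigma>) \<and>
    (\<forall>K\<in>connected_components_of
          (subtopology (config_topology n) (symmetric_configs_with_spectrum G n \<sigma>)).
       \<exists>c\<in>K. symmetric_config G c \<and> balanced n c) \<and>
    (\<forall>\<Gamma>\<in>topological_Burnside_types G.
       symmetric_configs_of_type G n \<sigma> \<Gamma> \<noteq> {} \<longrightarrow>
       (\<exists>c\<in>symmetric_configs_of_type G n \<sigma> \<Gamma>. symmetric_config G c \<and> balanced n c))"
proof (intro conjI ballI impI)
  let ?S = "symmetric_configs_with_spectrum G n \<sigma>"
  let ?Y = "subtopology (config_topology n) ?S"
  note G = assms(2,1)
  have K_sub: "K \<subseteq> ?S" if "K \<in> connected_components_of ?Y" for K
    using connected_components_of_subset[OF that] by auto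
  show "?S \<noteq> {}"
    using assms(3) by (auto simp: symmetric_configs_with_spectrum_def configs_with_spectrum_def)
  have "?S \<subseteq> configs_with_spectrum n \<sigma>" by (auto simp: symmetric_configs_with_spectrum_def)
  then show "closedin (subtopology (config_topology n) (configs_with_spectrum n \<sigma>)) ?S"
    by (rule closedin_subset_topspace[OF closedin_symmetric_configs_with_spectrum[OF G]])
  show "\<exists>c\<in>K. symmetric_config G c \<and> balanced n c" if "K \<in> connected_components_of ?Y" for K
    using symmetric_component_has_balanced[OF G that] K_sub[OF that]
    by (auto simp: symmetric_configs_with_spectrum_def)
  fix \<Gamma> assume "symmetric_configs_of_type G n \<sigma> \<Gamma> \<noteq> {}"
  then obtain c where c: "c \<in> ?S" "has_Burnside_type G c \<Gamma>" by (auto simp: symmetric_configs_of_type_def)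
  have "c \<in> topspace ?Y"
    using c(1) by (auto simp: topspace_config_topology symmetric_configs_with_spectrum_def configs_with_spectrum_def)
  then obtain K where K: "K \<in> connected_components_of ?Y" "c \<in> K"
    using Union_connected_components_of[of ?Y] by blast
  obtain c' where c': "c' \<in> K" "balanced n c'" using symmetric_component_has_balanced[OF G K(1)] by blast
  have "connectedin ?Y K" by (rule connectedin_connected_components_of[OF K(1)])
  then have "has_Burnside_type G c' \<Gamma>"
    using Burnside_type_constant_on_connected[OF G _ _ K(2) c'(1) c(2)] K_sub[OF K(1)]
    by (auto simp: connectedin_subtopology symmetric_configs_with_spectrum_def)
  then show "\<exists>c\<in>symmetric_configs_of_type G n \<sigma> \<Gamma>. symmetric_config G c \<and> balanced n c"
    using c' K_sub[OF K(1)]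
    by (intro bexI[of _ c']) (auto simp: symmetric_configs_of_type_def symmetric_configs_with_spectrum_def)
qed

end
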